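(* Let $\alpha,K,Q$ be positive integers with $K>1$, $\alpha<\frac Q2$ and $Q+\alpha$ even. Consider a private $\alpha$-cyclic PPMA-MADC model with $KQ$ mapper nodes, $K$ reducer nodes and $Q$ output functions. Then the $\left(KQ,\;KQ,\;(K-1)Q+\alpha,\;\frac{Q(Q-\alpha)}2\right)$ placement delivery array $\mathbf P$ constructed in the context corresponds to this model, and (through the coding scheme based on $\mathbf P$ described in the context, which satisfies the decoding and privacy requirements of the model) it achieves computation load $r=1$ and communication load $$L_p=\frac{Q-\alpha}{2\,Q\,(K-1)} .$$
   Context: Notation: $[n]=\{1,\dots,n\}$; $[a]_b=a$ if $a\le b$ and $[a]_b=a-b$ otherwise; $\oplus$ is bitwise XOR; $\mathbf y[i]$ is the $i$-th entry of a vector $\mathbf y$. **Placement delivery array (PDA).** A $(K',F',Z,S)$ PDA is an $F'\times K'$ array with entries in $\{*\}\cup[S]$ such that: each column contains exactly $Z$ symbols $*$; each integer of $[S]$ occurs at least once; and whenever two distinct entries, in positions $(f_1,k_1)$ and $(f_2,k_2)$, equal the same integer, then $f_1\ne f_2$, $k_1\ne k_2$ and the entries in positions $(f_1,k_2)$ and $(f_2,k_1)$ are both $*$. **Multi-access distributed computing (MADC).** There are $N$ files $W_1,\dots,W_N\in\mathbb F_{2^d}$ and $Q$ output functions $\phi_q(W_1,\dots,W_N)=h_q(v_{q,1},\dots,v_{q,N})$, $q\in[Q]$, where $v_{q,n}=g_{q,n}(W_n)\in\mathbb F_{2^\beta}$ is an intermediate value (IV) of $\beta$ bits, with map functions $g_{q,n}:\mathbb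 F_{2^d}\to\mathbb F_{2^\beta}$ and reduce functions $h_q:\mathbb F_{2^\beta}^N\to\mathbb F_{2^b}$. There are $\Lambda$ mapper nodes and $K$ reducer nodes $R_1,\dots,R_K$. The files are divided into $\Lambda$ disjoint batches of equal size $N/\Lambda$; each mapper stores exactly one batch (different mappers store different batches) and computes all IVs $v_{q,n}$, $q\in[Q]$, of the files in its batch. A reducer can retrieve the IVs computed by every mapper it is connected to. Each reducer is assigned one output function. **$\alpha$-cyclic PPMA-MADC (partial private mapper assignment) model.** The mappers are partitioned into $K$ disjoint blocks of equal size, $\mathcal M_1,\dots,\mathcal M_K$; here $\Lambda=KQ$ and $\mathcal M_k=\{M_k^f:f\in[Q]\}$, and $M_k^f$ stores batch $B_k^f$, which contains $\eta=N/(KQ)$ files. The partition is known to all reducers. Reducer $R_k$ is connected to every mapper in every block $\mathcal M_j$, $j\ne k$, and this is known to all reducers. Within its private block $\mathcal M_k$, $R_k$ is connected to exactly $\alpha$ mappers, which are consecutive under the cyclic wrap-around ordering of $\mathcal M_k$: the mappers $M_k^f$ with $f\in\{[a_k]_Q,[a_k+1]_Q,\dots,[a_k+\alpha-1]_Q\}$ for some $a_k\in[Q]$. The other reducers are aware of this cyclic-consecutive pattern but do not know the starting index $a_k$. Let $\mathcal R_k$ be the set of batches accessible to $R_k$. **Private model.** Reducer $R_k$ is assigned the function $\phi_{d_k}$, $d_k\in[Q]$. Given $d_k$ and $\mathcal R_k$, it generates and broadcasts a query $\mathbf y_k$ to all other reducers. After receiving all queries, each $R_k$ broadcasts a coded message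 $\mathbf X_k$ to all other reducers. The requirements, for every $k\in[K]$, are: - (Encoding) $H(\mathbf X_k\mid\mathcal R_k,\{\mathbf y_j\}_{j\in[K]})=0$; - (Decoding) $H(\phi_{d_k}\mid\mathcal R_k,d_k,\{\mathbf y_j\}_{j\in[K]},\{\mathbf X_j\}_{j\in[K]})=0$; - (Privacy: no other reducer learns $d_k$) $I(\{d_j\}_{j\in[K]};\{\mathbf y_j\}_{j\in[K]}\mid d_k,\mathcal R_k)=0$. **Loads.** The computation load $r$ is the total number of files mapped across the mapper nodes, divided by $N$. The communication load is the total number of bits of the coded messages $\mathbf X_1,\dots,\mathbf X_K$ broadcast by the reducers, divided by the total bit-length $QN\beta$ of all IVs. **The array $\mathbf P$.** Let $m=\frac{Q+\alpha}2$. Define a $Q\times Q$ array $B=(b_{r,c})$ as follows: rows $1,\dots,\alpha$ consist of the symbol $*$; for $r\in\{\alpha+1,\dots,m\}$ and $c\in[Q]$, $b_{r,c}=(r-\alpha-1)Q+c$; for $j\in\{1,\dots,m-\alpha\}$ and $c\in[Q]$, $b_{m+j,\,[c+m-j]_Q}=b_{m-j+1,\,c}$. Let $\mathbf P^{(2)}$ be the $Q\times Q$ array obtained from $B$ by cyclically shifting column $c$ downwards by $c-1$ positions, i.e. $\mathbf P^{(2)}_{[r+c-1]_Q,\,c}=b_{r,c}$ for $r,c\in[Q]$. Then $\mathbf P$ is the $K\times K$ block array whose diagonal blocks all equal $\mathbf P^{(2)}$ and whose off-diagonal blocks are the $Q\times Q$ array with all entries $*$. Put $S=\frac{Q(Q-\alpha)}2$,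 the number of integers in $\mathbf P$. **Correspondence of $\mathbf P$ with the model.** The $f$-th row of row block $k$ represents mapper $M_k^f$ and batch $B_k^f$. The $j$-th column of column block $k$ represents an "effective" reducer $R_k^j$, $j\in[Q]$; a $*$ in a column means that the batch of that row is accessible to the effective reducer of that column. The real reducer $R_k$, with starting index $a_k$, plays the role of $R_k^{a_k}$, whose column has its stars exactly in the rows of the batches in $\mathcal R_k$. The other columns of block $k$ represent virtual reducers. **Coding scheme based on $\mathbf P$.** Reducer $R_k$ takes as query $\mathbf y_k$ a uniformly random permutation of $[Q]$ subject to $\mathbf y_k[a_k]=d_k$; $\mathbf y_k[i]$ is viewed as the function index assigned to $R_k^i$. For $k\in[K]$ and $f,i\in[Q]$ with $\mathbf P^{(2)}_{f,i}\ne *$, let $U_{\mathbf y_k[i],B_k^f}=(v_{\mathbf y_k[i],n}:W_n\in B_k^f)$, a string of $\eta\beta$ bits, partitioned into $K-1$ equally sized packets $U^{l}_{\mathbf y_k[i],B_k^f}$, $l\in[K]\setminus\{k\}$. Reducer $R_k$ broadcasts $\mathbf X_k=\{X_k^t:t\in[S]\}$, where $$X_k^t=\bigoplus_{\substack{j\in[K]\setminus\{k\},\ f,i\in[Q]\\ \mathbf P^{(2)}_{f,i}=t}}U^{k}_{\mathbf y_j[i],B_j^f}.$$ *)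

theory Defs
  imports
    "HOL-Probability.Probability"
    "HOL-Library.Z2"
    "HOL-Combinatorics.Permutations"
begin

section \<open>Placement delivery arrays\<close>

text \<open>
  Arrays are indexed from 1; only the entries in the stated ranges matter.
  The symbol * is rendered as \<^term>\<open>None\<close>, an integer entry \<open>s\<close> as \<^term>\<open>Some s\<close>.
\<close>

type_synonym array = "nat \<Rightarrow> nat \<Rightarrow> nat option"

definition is_pda :: "nat \<Rightarrow> nat \<Rightarrow> nat \<Rightarrow> nat \<Rightarrow> array \<Rightarrow> bool" where
  "is_pda K F Z S A \<longleftrightarrow>
     (\<forall>f\<in>{1..F}. \<forall>k\<in>{1..K}. A f k \<in> insert None (Some ` {1..S})) \<and>
     (\<forall>k\<in>{1..K}. card {f\<in>{1..F}. A f k = None} = Z) \<and>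
     (\<forall>s\<in>{1..S}. \<exists>f\<in>{1..F}. \<exists>k\<in>{1..K}. A f k = Some s) \<and>
     (\<forall>s\<in>{1..S}. \<forall>f1\<in>{1..F}. \<forall>k1\<in>{1..K}. \<forall>f2\<in>{1..F}. \<forall>k2\<in>{1..K}.
        (f1, k1) \<noteq> (f2, k2) \<and> A f1 k1 = Some s \<and> A f2 k2 = Some s \<longrightarrow>
        f1 \<noteq> f2 \<and> k1 \<noteq> k2 \<and> A f1 k2 = None \<and> A f2 k1 = None)"

definition wrap :: "nat \<Rightarrow> nat \<Rightarrow> nat" where
  "wrap b a = (if a \<le> b then a else a - b)"

text \<open>
  The array \<open>B\<close>. In a row \<open>r = m + j\<close> with \<open>1 \<le> j \<le> m - \<alpha>\<close>, the column \<open>c\<close> receives the entry in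
  row \<open>m - j + 1\<close> of the column \<open>c'\<close> with \<open>c = [c' + m - j]\<^sub>Q\<close>. The row \<open>m - j + 1\<close> is one of
  \<open>\<alpha> + 1, \<dots>, m\<close>, so that the explicit formula for these rows applies to it.
\<close>

definition arr_B_upper :: "nat \<Rightarrow> nat \<Rightarrow> nat \<Rightarrow> nat \<Rightarrow> nat" where
  "arr_B_upper \<alpha> Q r c = (r - \<alpha> - 1) * Q + c"

definition arr_B :: "nat \<Rightarrow> nat \<Rightarrow> array" where
  "arr_B \<alpha> Q r c =
     (let m = (Q + \<alpha>) div 2 in
      if r \<le> \<alpha> then None
      else if r \<le> m then Some (arr_B_upper \<alpha> Q r c)
      else let j = r - m; c' = (THE c'. c' \<in> {1..Q} \<and> wrap Q (c' + m - j) = c)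
           in Some (arr_B_upper \<alpha> Q (m - j + 1) c'))"

definition arr_P2 :: "nat \<Rightarrow> nat \<Rightarrow> array" where
  "arr_P2 \<alpha> Q f c = arr_B \<alpha> Q (THE r. r \<in> {1..Q} \<and> wrap Q (r + c - 1) = f) c"

text \<open>
  The block array. The \<open>f\<close>-th row of row block \<open>k\<close> is the row \<open>(k - 1) * Q + f\<close>,
  and likewise for columns.
\<close>

definition arr_P :: "nat \<Rightarrow> nat \<Rightarrow> array" where
  "arr_P \<alpha> Q u v =
     (if (u - 1) div Q = (v - 1) div Q
      then arr_P2 \<alpha> Q ((u - 1) mod Q + 1) ((v - 1) mod Q + 1) else None)"

definition num_ints :: "nat \<Rightarrow> nat \<Rightarrow> nat" where
  "num_ints \<alpha> Q = Q * (Q - \<alpha>) div 2"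


section \<open>The cyclic PPMA-MADC model\<close>

text \<open>
  Elements of the field with \<open>2\<^sup>n\<close> elements are represented as bit strings of length \<open>n\<close>: only its
  cardinality and its addition (bitwise XOR) play a role. The type \<^typ>\<open>bit\<close> is the field with two
  elements, hence \<open>+\<close> on it is XOR.
\<close>

type_synonym bits = "bit list"

text \<open>
  Reducers, functions and files are numbered from 1. The mapper \<open>M\<^sub>k\<^sup>f\<close> is the pair \<open>(k, f)\<close>; it stores
  the batch \<open>batch k f\<close>, a set of file indices. The reduce function takes the list of the \<open>N\<close> IVs of
  a function, in the order of the files. The files and the demands follow arbitrary probability
  distributions.
\<close>

record madc =
  num_reducers :: nat
  num_functions :: nat
  access_width :: nat  \<comment> \<open>the parameter \<open>\<alpha>\<close>\<close>
  num_files :: nat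
  file_bits :: nat
  iv_bits :: nat
  out_bits :: nat
  batch :: "nat \<Rightarrow> nat \<Rightarrow> nat set"
  map_fun_of :: "nat \<Rightarrow> nat \<Rightarrow> bits \<Rightarrow> bits"
  reduce_fun_of :: "nat \<Rightarrow> bits list \<Rightarrow> bits"
  file_law :: "(nat \<Rightarrow> bits) pmf"
  demand_law :: "(nat \<Rightarrow> nat) pmf"

definition mappers :: "madc \<Rightarrow> (nat \<times> nat) set" where
  "mappers M = {1..num_reducers M} \<times> {1..num_functions M}"

definition batch_size :: "madc \<Rightarrow> nat" where
  "batch_size M = num_files M div (num_reducers M * num_functions M)"

definition cyclic_ppma_madc :: "madc \<Rightarrow> bool" where
  "cyclic_ppma_madc M \<longleftrightarrow>
     0 < num_reducers M \<and> 0 < num_functions M \<and>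
     access_width M \<in> {1..num_functions M} \<and>
     0 < num_files M \<and> num_reducers M * num_functions M dvd num_files M \<and>
     0 < file_bits M \<and> 0 < iv_bits M \<and> 0 < out_bits M \<and>
     disjoint_family_on (\<lambda>(k, f). batch M k f) (mappers M) \<and>
     (\<Union>(k, f)\<in>mappers M. batch M k f) = {1..num_files M} \<and>
     (\<forall>(k, f)\<in>mappers M. card (batch M k f) = batch_size M) \<and>
     (\<forall>q\<in>{1..num_functions M}. \<forall>n\<in>{1..num_files M}. \<forall>w.
        length w = file_bits M \<longrightarrow> length (map_fun_of M q n w) = iv_bits M) \<and>
     (\<forall>q\<in>{1..num_functions M}. \<forall>vs.
        length vs = num_files M \<and> (\<forall>v\<in>set vs. length v = iv_bits M) \<longrightarrow>
        length (reduce_fun_of M q vs) = out_bits M) \<and>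
     set_pmf (file_law M) \<subseteq> {1..num_files M} \<rightarrow>\<^sub>E {w. length w = file_bits M} \<and>
     set_pmf (demand_law M) \<subseteq> {1..num_reducers M} \<rightarrow>\<^sub>E {1..num_functions M}"

definition output_fun :: "madc \<Rightarrow> nat \<Rightarrow> (nat \<Rightarrow> bits) \<Rightarrow> bits" where
  "output_fun M q W =
     reduce_fun_of M q (map (\<lambda>n. map_fun_of M q n (W n)) [1..<num_files M + 1])"

definition connected_mappers :: "madc \<Rightarrow> nat \<Rightarrow> nat \<Rightarrow> (nat \<times> nat) set" where
  "connected_mappers M k a =
     {(j, f) \<in> mappers M.
        j = k \<longrightarrow> f \<in> wrap (num_functions M) ` {a..<a + access_width M}}"

text \<open>
  The batches accessible to the reducer \<open>k\<close> with starting index \<open>a\<close> when the files are \<open>W\<close>: each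
  such batch is labelled with the mapper storing it and given by the contents of its files.
\<close>

type_synonym batches = "((nat \<times> nat) \<times> (nat \<Rightarrow> bits)) set"

definition accessible :: "madc \<Rightarrow> (nat \<Rightarrow> bits) \<Rightarrow> nat \<Rightarrow> nat \<Rightarrow> batches" where
  "accessible M W k a =
     (\<lambda>(j, f). ((j, f), restrict W (batch M j f))) ` connected_mappers M k a"

text \<open>
  An array with rows \<open>(j, f)\<close> (mappers) and columns \<open>(k, a)\<close> (effective reducers) corresponds to the
  model if, for every possible starting index \<open>a\<close> of the reducer \<open>k\<close>, the stars of the column
  \<open>(k, a)\<close> are exactly in the rows of the mappers this reducer is connected to.
\<close>

definition corresponds :: "array \<Rightarrow> madc \<Rightarrow> bool" where
  "corresponds A M \<longleftrightarrow>
     (\<forall>k\<in>{1..num_reducers M}. \<forall>a\<in>{1..num_functions M}.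
        {(j, f) \<in> mappers M.
           A ((j - 1) * num_functions M + f) ((k - 1) * num_functions M + a) = None}
        = connected_mappers M k a)"


section \<open>Private schemes\<close>

text \<open>
  The query of reducer \<open>k\<close> is drawn from a distribution depending on its starting index, its
  accessible batches and its demand. (Unless \<open>\<alpha> = Q\<close>, the labels of the accessible batches
  determine the starting index.) Messages are arbitrary functions of the outcome; that they are
  computable from what the sender knows is the encoding requirement below. A message
  is a list of bit strings.
\<close>

record 'y outcome =
  files :: "nat \<Rightarrow> bits"
  demand :: "nat \<Rightarrow> nat"
  start :: "nat \<Rightarrow> nat"
  queries :: "nat \<Rightarrow> 'y"

record 'y scheme =
  query :: "nat \<Rightarrow> nat \<Rightarrow> batches \<Rightarrow> nat \<Rightarrow> 'y pmf"
  message :: "nat \<Rightarrow> 'y outcome \<Rightarrow> bits list"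

text \<open>
  Files, demands and starting indices are independent, and the starting indices, which the other
  reducers do not know, are independent and uniform. Given these, the reducers draw their queries
  independently.
\<close>

definition outcome_pmf :: "madc \<Rightarrow> 'y scheme \<Rightarrow> 'y outcome pmf" where
  "outcome_pmf M C = do {
     W \<leftarrow> file_law M;
     d \<leftarrow> demand_law M;
     a \<leftarrow> Pi_pmf {1..num_reducers M} undefined (\<lambda>_. pmf_of_set {1..num_functions M});
     y \<leftarrow> Pi_pmf {1..num_reducers M} undefined
            (\<lambda>k. query C k (a k) (accessible M W k (a k)) (d k));
     return_pmf \<lparr>files = W, demand = d, start = a, queries = y\<rparr>
   }"

text \<open>
  The library's (conditional) information measures, in bits. The sample space is cut down to the
  support of the distribution, so that all random variables have finite range if it is finite.
\<close>

definition supp_space :: "'a pmf \<Rightarrow> 'a measure" where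
  "supp_space p = restrict_space (measure_pmf p) (set_pmf p)"

definition cond_ent :: "'a pmf \<Rightarrow> ('a \<Rightarrow> 'x) \<Rightarrow> ('a \<Rightarrow> 'z) \<Rightarrow> real" where
  "cond_ent p X Z =
     prob_space.conditional_entropy (supp_space p) 2
       (count_space (X ` space (supp_space p))) (count_space (Z ` space (supp_space p))) X Z"

definition cond_mut_inf :: "'a pmf \<Rightarrow> ('a \<Rightarrow> 'x) \<Rightarrow> ('a \<Rightarrow> 'y) \<Rightarrow> ('a \<Rightarrow> 'z) \<Rightarrow> real" where
  "cond_mut_inf p X Y Z =
     prob_space.conditional_mutual_information (supp_space p) 2
       (count_space (X ` space (supp_space p))) (count_space (Y ` space (supp_space p)))
       (count_space (Z ` space (supp_space p))) X Y Z"

definition reach :: "madc \<Rightarrow> nat \<Rightarrow> 'y outcome \<Rightarrow> batches" where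
  "reach M k \<omega> = accessible M (files \<omega>) k (start \<omega> k)"

definition all_messages :: "madc \<Rightarrow> 'y scheme \<Rightarrow> 'y outcome \<Rightarrow> nat \<Rightarrow> bits list" where
  "all_messages M C \<omega> = restrict (\<lambda>j. message C j \<omega>) {1..num_reducers M}"

definition encoding_req :: "madc \<Rightarrow> 'y scheme \<Rightarrow> bool" where
  "encoding_req M C \<longleftrightarrow>
     (\<forall>k\<in>{1..num_reducers M}.
        cond_ent (outcome_pmf M C) (message C k) (\<lambda>\<omega>. (reach M k \<omega>, queries \<omega>)) = 0)"

definition decoding_req :: "madc \<Rightarrow> 'y scheme \<Rightarrow> bool" where
  "decoding_req M C \<longleftrightarrow>
     (\<forall>k\<in>{1..num_reducers M}.
        cond_ent (outcome_pmf M C)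
          (\<lambda>\<omega>. output_fun M (demand \<omega> k) (files \<omega>))
          (\<lambda>\<omega>. (reach M k \<omega>, demand \<omega> k, queries \<omega>, all_messages M C \<omega>)) = 0)"

definition privacy_req :: "madc \<Rightarrow> 'y scheme \<Rightarrow> bool" where
  "privacy_req M C \<longleftrightarrow>
     (\<forall>k\<in>{1..num_reducers M}.
        cond_mut_inf (outcome_pmf M C) demand queries (\<lambda>\<omega>. (demand \<omega> k, reach M k \<omega>)) = 0)"

definition computation_load :: "madc \<Rightarrow> real" where
  "computation_load M = (\<Sum>(k, f)\<in>mappers M. real (card (batch M k f))) / real (num_files M)"

definition communication_load :: "madc \<Rightarrow> 'y scheme \<Rightarrow> 'y outcome \<Rightarrow> real" where
  "communication_load M C \<omega> =
     real (\<Sum>k\<in>{1..num_reducers M}. sum_list (map length (message C k \<omega>)))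
     / real (num_functions M * num_files M * iv_bits M)"


section \<open>The coding scheme based on the array\<close>

definition iv_string :: "madc \<Rightarrow> (nat \<Rightarrow> bits) \<Rightarrow> nat \<Rightarrow> nat set \<Rightarrow> bits" where
  "iv_string M W q B = concat (map (\<lambda>n. map_fun_of M q n (W n)) (sorted_list_of_set B))"

definition packet_len :: "madc \<Rightarrow> nat" where
  "packet_len M = batch_size M * iv_bits M div (num_reducers M - 1)"

text \<open>
  The packet with index \<open>l\<close>, an element of \<open>{1..K} - {k}\<close>, of a string split into \<open>K - 1\<close> packets,
  which appear in the order of their indices.
\<close>

definition packet :: "madc \<Rightarrow> nat \<Rightarrow> nat \<Rightarrow> bits \<Rightarrow> bits" where
  "packet M k l u =
     take (packet_len M) (drop (card {i \<in> {1..num_reducers M} - {k}. i < l} * packet_len M) u)"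

definition xor_strings :: "nat \<Rightarrow> ('i \<Rightarrow> bits) \<Rightarrow> 'i set \<Rightarrow> bits" where
  "xor_strings len u I = map (\<lambda>p. \<Sum>i\<in>I. u i ! p) [0..<len]"

definition array_query :: "madc \<Rightarrow> nat \<Rightarrow> nat \<Rightarrow> batches \<Rightarrow> nat \<Rightarrow> (nat \<Rightarrow> nat) pmf" where
  "array_query M k a Rk d = pmf_of_set {y. y permutes {1..num_functions M} \<and> y a = d}"

definition array_symbol :: "madc \<Rightarrow> nat \<Rightarrow> (nat \<Rightarrow> nat) outcome \<Rightarrow> nat \<Rightarrow> bits" where
  "array_symbol M k \<omega> t =
     xor_strings (packet_len M)
       (\<lambda>(j, f, i). packet M j k (iv_string M (files \<omega>) (queries \<omega> j i) (batch M j f)))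
       {(j, f, i). j \<in> {1..num_reducers M} - {k} \<and>
          f \<in> {1..num_functions M} \<and> i \<in> {1..num_functions M} \<and>
          arr_P2 (access_width M) (num_functions M) f i = Some t}"

definition array_message :: "madc \<Rightarrow> nat \<Rightarrow> (nat \<Rightarrow> nat) outcome \<Rightarrow> bits list" where
  "array_message M k \<omega> =
     map (array_symbol M k \<omega>) [1..<num_ints (access_width M) (num_functions M) + 1]"

definition array_scheme :: "madc \<Rightarrow> (nat \<Rightarrow> nat) scheme" where
  "array_scheme M = \<lparr>query = array_query M, message = array_message M\<rparr>"

end

theory Submission
  imports Defs
begin

text \<open>
  Measure the row of an entry of \<open>arr_P2\<close> by its cyclic offset from the column. The stars are
  the offsets below \<open>\<alpha>\<close>, and an integer occurs at \<open>(c + s, c)\<close> and at \<open>(c + \<alpha> - 1, c + s)\<close> for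
  a unique \<open>c\<close> and a unique \<open>s\<close> between \<open>\<alpha>\<close> and \<open>m - 1\<close>. The two positions obtained by
  exchanging the columns have the offsets \<open>0\<close> and \<open>\<alpha> - 1\<close>, so they are stars.

  Encoding and decoding only require that a quantity be determined by what is known on the support
  of the distribution of the outcome. For decoding, the starting index is the preimage
  of the own demand under the own query, and the array property makes all but one packet of a
  relevant coded symbol known.

  For privacy, a permutation sending a uniformly random index to a fixed demand and being otherwise
  uniform is a uniform permutation. Hence the queries of the others do not depend on their demands,
  and the conditional law of all queries is a kernel of the own demand and starting index.
\<close>

section \<open>Vanishing information measures\<close>

lemma information_space_supp_space: "information_space (supp_space p) 2"
proof -
  have "emeasure (measure_pmf p) (set_pmf p) = 1"
    by (intro measure_pmf.emeasure_eq_1_AE) (auto simp: AE_measure_pmf_iff)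
  then have "prob_space (supp_space p)"
    unfolding supp_space_def by (intro prob_space_restrict_space) auto
  then show ?thesis
    by (intro information_space.intro information_space_axioms.intro) auto
qed

lemma space_supp_space [simp]: "space (supp_space p) = set_pmf p"
  by (simp add: supp_space_def space_restrict_space)

text \<open>Every subset of the support is measurable in \<open>supp_space p\<close>, so any
  function on a finite support is simple. This makes the finite-sum formulas for the information
  measures applicable.\<close>

lemma simple_distributed_supp_space:
  assumes "finite (set_pmf p)"
  shows "simple_distributed (supp_space p) X (pmf (map_pmf X p))"
proof -
  interpret information_space "supp_space p" 2 by (rule information_space_supp_space)
  have sets: "sets (supp_space p) = Pow (set_pmf p)"
    by (auto simp: supp_space_def sets_restrict_space)
  show ?thesis
  proof (rule simple_distributedI)
    show "simple_function (supp_space p) X"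
      using assms by (simp add: simple_function_def sets)
    fix x
    have "measure (supp_space p) (X -` {x} \<inter> set_pmf p) = measure p (X -` {x} \<inter> set_pmf p)"
      unfolding supp_space_def by (intro measure_restrict_space) auto
    then show "pmf (map_pmf X p) x = measure (supp_space p) (X -` {x} \<inter> space (supp_space p))"
      by (simp add: pmf_map measure_Int_set_pmf)
  qed simp
qed

text \<open>When \<open>Z\<close> determines \<open>X\<close> on the support, a joint value has the
  same mass as its \<open>Z\<close>-component, so every logarithm in the sum is taken of 1.\<close>

lemma cond_ent_eq_0:
  assumes fin: "finite (set_pmf p)"
    and fn: "\<And>\<omega> \<omega>'. \<omega> \<in> set_pmf p \<Longrightarrow> \<omega>' \<in> set_pmf p \<Longrightarrow> Z \<omega> = Z \<omega>' \<Longrightarrow> X \<omega> = X \<omega>'"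
  shows "cond_ent p X Z = 0"
proof -
  interpret information_space "supp_space p" 2 by (rule information_space_supp_space)
  have "pmf (map_pmf (\<lambda>\<omega>. (X \<omega>, Z \<omega>)) p) (X \<omega>, Z \<omega>) = pmf (map_pmf Z p) (Z \<omega>)"
    if "\<omega> \<in> set_pmf p" for \<omega>
  proof -
    have "(\<lambda>\<omega>. (X \<omega>, Z \<omega>)) -` {(X \<omega>, Z \<omega>)} \<inter> set_pmf p = Z -` {Z \<omega>} \<inter> set_pmf p"
      using fn[OF _ that] by auto
    then have "measure p ((\<lambda>\<omega>. (X \<omega>, Z \<omega>)) -` {(X \<omega>, Z \<omega>)}) = measure p (Z -` {Z \<omega>})"
      by (metis measure_Int_set_pmf)
    then show ?thesis by (simp add: pmf_map)
  qed
  then show ?thesis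
    unfolding cond_ent_def
    by (subst conditional_entropy_eq[OF simple_distributed_supp_space[OF fin] simple_distributed_supp_space[OF fin]])
      (auto intro!: sum.neutral)
qed

lemma pmf_bind_kernel:
  "pmf (do {r \<leftarrow> R; y \<leftarrow> H r; return_pmf (y, r)}) (y, r) = pmf R r * pmf (H r) y"
proof -
  have "pmf (do {y \<leftarrow> H r'; return_pmf (y, r')}) (y, r) = indicator {r} r' * pmf (H r) y" for r'
  proof -
    have "(\<lambda>y. (y, r')) -` {(y, r)} = (if r' = r then {y} else {})" by auto
    then show ?thesis
      by (auto simp: map_pmf_def[symmetric] pmf_map measure_pmf_single)
  qed
  then show ?thesis by (simp add: pmf_bind measure_pmf_single)
qed

text \<open>The hypothesis \<open>kernel\<close> is a Markov condition: given \<open>z\<close>, the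
  value \<open>y\<close> is drawn without regard to \<open>x\<close>. The masses of (x, y, z) and of
  (y, z) then carry the same factor \<open>pmf (H z) y\<close>, which cancels in the
  logarithm.\<close>

lemma cond_mut_inf_eq_0:
  assumes fin: "finite (set_pmf p)"
    and kernel: "map_pmf (\<lambda>\<omega>. (Y \<omega>, X \<omega>, Z \<omega>)) p =
      do {(x, z) \<leftarrow> R; y \<leftarrow> H z; return_pmf (y, x, z)}"
  shows "cond_mut_inf p X Y Z = 0"
proof -
  interpret information_space "supp_space p" 2 by (rule information_space_supp_space)
  have R: "map_pmf (\<lambda>\<omega>. (X \<omega>, Z \<omega>)) p = R"
    using arg_cong[OF kernel, of "map_pmf snd"]
    by (simp add: map_pmf_comp map_bind_pmf case_prod_beta' bind_return_pmf')
  have xyz: "pmf (map_pmf (\<lambda>\<omega>. (X \<omega>, Y \<omega>, Z \<omega>)) p) (x, y, z) =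
      pmf (map_pmf (\<lambda>\<omega>. (X \<omega>, Z \<omega>)) p) (x, z) * pmf (H z) y" for x y z
  proof -
    have "pmf (map_pmf (\<lambda>\<omega>. (Y \<omega>, X \<omega>, Z \<omega>)) p) (y, x, z) = pmf R (x, z) * pmf (H z) y"
      unfolding kernel using pmf_bind_kernel[of R "\<lambda>r. H (snd r)" y "(x, z)"]
      by (simp add: case_prod_beta')
    moreover have "(\<lambda>\<omega>. (Y \<omega>, X \<omega>, Z \<omega>)) -` {(y, x, z)} = (\<lambda>\<omega>. (X \<omega>, Y \<omega>, Z \<omega>)) -` {(x, y, z)}"
      by auto
    ultimately show ?thesis by (simp add: R pmf_map)
  qed
  have yz: "pmf (map_pmf (\<lambda>\<omega>. (Y \<omega>, Z \<omega>)) p) (y, z) = pmf (map_pmf Z p) z * pmf (H z) y" for y z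
  proof -
    have "map_pmf (\<lambda>\<omega>. (Y \<omega>, Z \<omega>)) p = do {z \<leftarrow> map_pmf snd R; y \<leftarrow> H z; return_pmf (y, z)}"
      using arg_cong[OF kernel, of "map_pmf (\<lambda>(y, x, z). (y, z))"]
      by (simp add: map_pmf_comp map_bind_pmf case_prod_beta' bind_map_pmf)
    moreover have "map_pmf snd R = map_pmf Z p"
      by (simp add: R[symmetric] map_pmf_comp)
    ultimately show ?thesis by (simp add: pmf_bind_kernel)
  qed
  have "log 2 (pmf (map_pmf (\<lambda>\<omega>. (X \<omega>, Y \<omega>, Z \<omega>)) p) (X \<omega>, Y \<omega>, Z \<omega>) /
      (pmf (map_pmf (\<lambda>\<omega>. (X \<omega>, Z \<omega>)) p) (X \<omega>, Z \<omega>) *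
        (pmf (map_pmf (\<lambda>\<omega>. (Y \<omega>, Z \<omega>)) p) (Y \<omega>, Z \<omega>) / pmf (map_pmf Z p) (Z \<omega>)))) = 0"
    if "\<omega> \<in> set_pmf p" for \<omega>
  proof -
    \<comment> \<open>Positive mass of the triple and of its \<open>Z\<close>-component makes every
      factor of the quotient nonzero, so it reduces to 1.\<close>
    have "pmf (map_pmf Z p) (Z \<omega>) \<noteq> 0"
      "pmf (map_pmf (\<lambda>\<omega>. (X \<omega>, Y \<omega>, Z \<omega>)) p) (X \<omega>, Y \<omega>, Z \<omega>) \<noteq> 0"
      using that by (auto simp: set_pmf_iff[symmetric])
    then show ?thesis by (simp add: xyz yz)
  qed
  then show ?thesis
    unfolding cond_mut_inf_def
    by (subst conditional_mutual_information_eq[OF simple_distributed_supp_space[OF fin]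
          simple_distributed_supp_space[OF fin] simple_distributed_supp_space[OF fin]
          simple_distributed_supp_space[OF fin]])
      (auto intro!: sum.neutral)
qed

section \<open>Uniformly random permutations\<close>

text \<open>With \<open>S = {1..Q}\<close> this is the set from which a query with starting index
  \<open>a\<close> and demand \<open>d\<close> is drawn uniformly.\<close>

definition pinned_perms :: "'a set \<Rightarrow> 'a \<Rightarrow> 'a \<Rightarrow> ('a \<Rightarrow> 'a) set" where
  "pinned_perms S a d = {y. y permutes S \<and> y a = d}"

lemma finite_pinned_perms: "finite S \<Longrightarrow> finite (pinned_perms S a d)"
  by (rule finite_subset[OF _ finite_permutations]) (auto simp: pinned_perms_def)

lemma pinned_perms_ne: "a \<in> S \<Longrightarrow> d \<in> S \<Longrightarrow> pinned_perms S a d \<noteq> {}"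
  using permutes_swap_id[of a S d] by (auto simp: pinned_perms_def intro!: exI[of _ "Transposition.transpose a d"])

text \<open>Precomposition with the transposition of \<open>a\<close> and \<open>b\<close> is its
  own inverse and moves the preimage of \<open>d\<close> from \<open>a\<close> to
  \<open>b\<close>.\<close>

lemma card_pinned_perms:
  assumes "a \<in> S" "b \<in> S"
  shows "card (pinned_perms S a d) = card (pinned_perms S b d)"
proof -
  have t: "Transposition.transpose a b permutes S" using assms by (rule permutes_swap_id)
  have "bij_betw (\<lambda>y. y \<circ> Transposition.transpose a b) (pinned_perms S a d) (pinned_perms S b d)"
    by (rule bij_betwI[where g = "\<lambda>y. y \<circ> Transposition.transpose a b"])
      (auto simp: pinned_perms_def comp_assoc intro: permutes_compose[OF t])
  then show ?thesis by (rule bij_betw_same_card)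
qed

text \<open>For fixed \<open>d\<close> the pinned sets partition the permutations by the preimage of
  \<open>d\<close> into classes of equal size. A uniform class followed by a uniform member of it is
  a uniform permutation.\<close>

lemma bind_pinned_perms:
  assumes "finite S" "d \<in> S"
  shows "do {a \<leftarrow> pmf_of_set S; pmf_of_set (pinned_perms S a d)} = pmf_of_set {y. y permutes S}"
proof -
  have eq: "{y. y permutes S} = (\<Union>a\<in>S. pinned_perms S a d)"
  proof (intro equalityI subsetI)
    fix y assume y: "y \<in> {y. y permutes S}"
    then have "d \<in> y ` S" using assms(2) permutes_image[of y S] by simp
    then show "y \<in> (\<Union>a\<in>S. pinned_perms S a d)" using y by (auto simp: pinned_perms_def)
  qed (auto simp: pinned_perms_def)
  have "disjoint_family_on (\<lambda>a. pinned_perms S a d) S"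
    unfolding disjoint_family_on_def
  proof (intro ballI impI)
    fix a b assume "a \<in> S" "b \<in> S" "a \<noteq> b"
    then show "pinned_perms S a d \<inter> pinned_perms S b d = {}"
      using inj_eq[OF permutes_inj] by (fastforce simp: pinned_perms_def)
  qed
  then show ?thesis
    unfolding eq
  proof (intro pmf_of_set_UN[symmetric])
    show "finite (\<Union>a\<in>S. pinned_perms S a d)" using assms(1) finite_pinned_perms by auto
    show "S \<noteq> {}" using assms(2) by auto
    show "pinned_perms S a d \<noteq> {}" if "a \<in> S" for a using pinned_perms_ne[OF that assms(2)] .
    \<comment> \<open>The common size is represented by the class with index \<open>d\<close>, which
      is known to lie in \<open>S\<close>.\<close>
    show "card (pinned_perms S a d) = card (pinned_perms S d d)" if "a \<in> S" for a
      using card_pinned_perms[OF that assms(2)] .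
  qed
qed

text \<open>Only the index \<open>a k\<close> is kept, so each other coordinate is averaged over its
  own index independently and becomes \<open>V\<close> by \<open>hide\<close>.\<close>

lemma Pi_pmf_hide_others:
  assumes "finite I" "k \<in> I" and hide: "\<And>j. j \<in> I - {k} \<Longrightarrow> bind_pmf U (\<lambda>a. q j a) = V"
  shows "do {a \<leftarrow> Pi_pmf I dflt (\<lambda>_. U); y \<leftarrow> Pi_pmf I dflt' (\<lambda>j. q j (a j)); return_pmf (y, a k)} =
    do {a \<leftarrow> U; x \<leftarrow> q k a; f \<leftarrow> Pi_pmf (I - {k}) dflt' (\<lambda>_. V); return_pmf (f(k := x), a)}"
proof -
  define J where "J = I - {k}"
  have I: "I = insert k J" "finite J" "k \<notin> J"
    using assms by (auto simp: J_def)
  have *: "Pi_pmf J dflt' (\<lambda>j. q j (if j = k then a else f j)) = Pi_pmf J dflt' (\<lambda>j. q j (f j))" for f a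
    using I by (intro Pi_pmf_cong) auto
  \<comment> \<open>A product of mixtures is a mixture of products, so the averaging can be done
    coordinatewise.\<close>
  have J: "do {f \<leftarrow> Pi_pmf J dflt (\<lambda>_. U); Pi_pmf J dflt' (\<lambda>j. q j (f j))} = Pi_pmf J dflt' (\<lambda>_. V)"
    using I(2) hide by (subst Pi_pmf_bind[symmetric]) (auto simp: J_def intro!: Pi_pmf_cong)
  have "do {a \<leftarrow> Pi_pmf I dflt (\<lambda>_. U); y \<leftarrow> Pi_pmf I dflt' (\<lambda>j. q j (a j)); return_pmf (y, a k)} =
    do {a \<leftarrow> U; f \<leftarrow> Pi_pmf J dflt (\<lambda>_. U); x \<leftarrow> q k a; g \<leftarrow> Pi_pmf J dflt' (\<lambda>j. q j (f j));
        return_pmf (g(k := x), a)}"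
    unfolding I(1) Pi_pmf_insert'[OF I(2,3)] by (simp add: bind_assoc_pmf bind_return_pmf *)
  \<comment> \<open>The draw \<open>x\<close> does not involve \<open>f\<close>; moving it forward
    makes the draws of \<open>f\<close> and \<open>g\<close> adjacent, as \<open>J\<close>
    needs.\<close>
  also have "\<dots> = do {a \<leftarrow> U; x \<leftarrow> q k a; f \<leftarrow> Pi_pmf J dflt (\<lambda>_. U); g \<leftarrow> Pi_pmf J dflt' (\<lambda>j. q j (f j));
        return_pmf (g(k := x), a)}"
    by (subst (2) bind_commute_pmf) (rule refl)
  also have "\<dots> = do {a \<leftarrow> U; x \<leftarrow> q k a; g \<leftarrow> Pi_pmf J dflt' (\<lambda>_. V); return_pmf (g(k := x), a)}"
    unfolding J[symmetric] by (simp add: bind_assoc_pmf)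
  finally show ?thesis by (simp add: J_def)
qed

section \<open>The array\<close>

lemma wrap_mem: "x \<in> {1..2 * b} \<Longrightarrow> wrap b x \<in> {1..b}"
  by (auto simp: wrap_def)

lemma wrap_add_eqD:
  assumes "wrap Q (c + x) = wrap Q (c + y)" and "c \<in> {1..Q}" "x < Q" "y < Q"
  shows "x = y"
  using assms by (auto simp: wrap_def split: if_splits)

lemma ex_wrap_offset:
  assumes "f \<in> {1..Q}" "c \<in> {1..Q}"
  obtains x where "x < Q" "f = wrap Q (c + x)"
proof (cases "c \<le> f")
  case True
  then show ?thesis using assms by (intro that[of "f - c"]) (auto simp: wrap_def)
next
  case False
  then show ?thesis using assms by (intro that[of "f + Q - c"]) (auto simp: wrap_def)
qed

text \<open>
  Positions of the shifted array are described by the column \<open>c\<close> and the offset \<open>x\<close> of the row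
  from it, which is one less than the row of \<open>B\<close> the entry comes from.
\<close>
lemma arr_P2_wrap:
  assumes "c \<in> {1..Q}" "x < Q"
  shows "arr_P2 \<alpha> Q (wrap Q (c + x)) c = arr_B \<alpha> Q (Suc x) c"
proof -
  have "(THE r. r \<in> {1..Q} \<and> wrap Q (r + c - 1) = wrap Q (c + x)) = Suc x"
  proof (rule the_equality)
    fix r assume r: "r \<in> {1..Q} \<and> wrap Q (r + c - 1) = wrap Q (c + x)"
    then have "wrap Q (c + (r - 1)) = wrap Q (c + x)"
      by (metis Nat.add_diff_assoc2 add.commute atLeastAtMost_iff)
    from wrap_add_eqD[OF this] show "r = Suc x" using r assms by auto
  qed (use assms in \<open>auto simp: ac_simps\<close>)
  then show ?thesis by (simp add: arr_P2_def)
qed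

text \<open>Introducing \<open>m\<close> by \<open>Q + \<alpha> = 2 * m\<close> keeps the arithmetic
  free of rounded division.\<close>

locale array_params =
  fixes \<alpha> Q m :: nat
  assumes alpha_pos: "0 < \<alpha>" and alpha_less: "\<alpha> < Q" and double_m: "Q + \<alpha> = 2 * m"
begin

lemma m_bounds: "\<alpha> < m" "m < Q" "0 < Q" "(Q + \<alpha>) div 2 = m"
  using alpha_less double_m by auto

lemma arr_B_low: "x < \<alpha> \<Longrightarrow> arr_B \<alpha> Q (Suc x) c = None"
  by (simp add: arr_B_def)

lemma arr_B_mid: "x \<in> {\<alpha>..<m} \<Longrightarrow> arr_B \<alpha> Q (Suc x) c = Some ((x - \<alpha>) * Q + c)"
  using m_bounds by (simp add: arr_B_def arr_B_upper_def Let_def)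

text \<open>Take \<open>j = m - s\<close>: the row \<open>m + j\<close> is \<open>2 * m - s\<close>,
  the row it mirrors is \<open>m - j + 1 = s + 1\<close>, and the column shift \<open>m - j\<close>
  is \<open>s\<close>.\<close>

lemma arr_B_high:
  assumes "s \<in> {\<alpha>..<m}" "c \<in> {1..Q}"
  shows "arr_B \<alpha> Q (2 * m - s) (wrap Q (c + s)) = Some ((s - \<alpha>) * Q + c)"
proof -
  have j: "c' + m - (2 * m - s - m) = c' + s" for c'
    using assms by auto
  have "(THE c'. c' \<in> {1..Q} \<and> wrap Q (c' + s) = wrap Q (c + s)) = c"
  proof (rule the_equality)
    fix c' assume "c' \<in> {1..Q} \<and> wrap Q (c' + s) = wrap Q (c + s)"
    then show "c' = c" using assms by (auto simp: wrap_def split: if_splits)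
  qed (use assms in auto)
  moreover have "m - (2 * m - s - m) + 1 - \<alpha> - 1 = s - \<alpha>" "\<not> 2 * m - s \<le> \<alpha>" "\<not> 2 * m - s \<le> m"
    using assms m_bounds by auto
  ultimately show ?thesis
    by (simp add: arr_B_def arr_B_upper_def Let_def m_bounds j)
qed

lemma arr_P2_None_iff:
  assumes "f \<in> {1..Q}" "c \<in> {1..Q}"
  shows "arr_P2 \<alpha> Q f c = None \<longleftrightarrow> (\<exists>x<\<alpha>. f = wrap Q (c + x))"
proof -
  obtain x where x: "x < Q" "f = wrap Q (c + x)"
    using ex_wrap_offset[OF assms] .
  have "arr_P2 \<alpha> Q f c = None \<longleftrightarrow> x < \<alpha>"
    using assms by (auto simp: x arr_P2_wrap arr_B_def Let_def)
  moreover have "(\<exists>y<\<alpha>. f = wrap Q (c + y)) \<longleftrightarrow> x < \<alpha>"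
    using wrap_add_eqD[of Q c x] x assms alpha_less by (metis order.strict_trans)
  ultimately show ?thesis by (simp only:)
qed

lemma arr_P2_first:
  assumes "s \<in> {\<alpha>..<m}" "c \<in> {1..Q}"
  shows "arr_P2 \<alpha> Q (wrap Q (c + s)) c = Some ((s - \<alpha>) * Q + c)"
  using assms m_bounds by (subst arr_P2_wrap) (auto simp: arr_B_mid)

text \<open>The offset \<open>2 * m - s - 1\<close> leads from the column \<open>c + s\<close> to
  \<open>c + 2 * m - 1 = c + Q + \<alpha> - 1\<close>, which is \<open>c + \<alpha> - 1\<close>
  modulo \<open>Q\<close>.\<close>

lemma arr_P2_second:
  assumes "s \<in> {\<alpha>..<m}" "c \<in> {1..Q}"
  shows "arr_P2 \<alpha> Q (wrap Q (c + \<alpha> - 1)) (wrap Q (c + s)) = Some ((s - \<alpha>) * Q + c)"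
proof -
  have "wrap Q (c + \<alpha> - 1) = wrap Q (wrap Q (c + s) + (2 * m - s - 1))"
    using assms m_bounds alpha_pos double_m[symmetric] by (auto simp: wrap_def)
  moreover have "wrap Q (c + s) \<in> {1..Q}"
    using assms m_bounds by (intro wrap_mem) auto
  moreover have "2 * m - s - 1 < Q" "Suc (2 * m - s - 1) = 2 * m - s"
    using assms double_m alpha_less by auto
  ultimately show ?thesis
    using arr_B_high[OF assms] arr_P2_wrap[of "wrap Q (c + s)" Q "2 * m - s - 1" \<alpha>] by metis
qed

text \<open>The second of the two positions has the offset \<open>2m - s - 1\<close>.\<close>
lemma arr_P2_SomeD:
  assumes "f \<in> {1..Q}" "c \<in> {1..Q}" "arr_P2 \<alpha> Q f c = Some t"
  obtains s c0 where "s \<in> {\<alpha>..<m}" "c0 \<in> {1..Q}" "t = (s - \<alpha>) * Q + c0"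
    "(f, c) = (wrap Q (c0 + s), c0) \<or> (f, c) = (wrap Q (c0 + \<alpha> - 1), wrap Q (c0 + s))"
proof -
  obtain x where x: "x < Q" "f = wrap Q (c + x)"
    using ex_wrap_offset assms by blast
  consider "x < \<alpha>" | "x \<in> {\<alpha>..<m}" | "x \<in> {m..<Q}"
    using x by force
  then show ?thesis
  proof cases
    case 1
    then show ?thesis using assms x by (auto simp: arr_P2_wrap arr_B_low)
  next
    case 2
    then show ?thesis using assms x arr_P2_first[OF 2 assms(2)] by (intro that[of x c]) auto
  next
    case 3
    \<comment> \<open>This inverts the offset of a second occurrence. Then \<open>c0\<close> lies
      \<open>s\<close> columns before \<open>c\<close>, with \<open>Q\<close> added to avoid a
      negative difference.\<close>
    define s where "s = 2 * m - x - 1"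
    define c0 where "c0 = wrap Q (c + (Q - s))"
    have s: "s \<in> {\<alpha>..<m}"
      using 3 double_m m_bounds unfolding s_def by (simp; linarith)
    have c0: "c0 \<in> {1..Q}"
      unfolding c0_def using assms by (intro wrap_mem) auto
    have c: "c = wrap Q (c0 + s)"
      using s m_bounds assms by (auto simp: c0_def wrap_def)
    have "x = 2 * m - s - 1"
      using 3 double_m m_bounds by (auto simp: s_def)
    then have f: "f = wrap Q (c0 + \<alpha> - 1)"
      unfolding x(2) c using c0 s m_bounds double_m[symmetric] alpha_pos by (auto simp: wrap_def)
    show ?thesis
      using s c0 c f arr_P2_second[OF s c0] assms(3) by (intro that[of s c0]) auto
  qed
qed

lemma num_ints_eq: "num_ints \<alpha> Q = (m - \<alpha>) * Q"
proof -
  have "Q - \<alpha> = 2 * (m - \<alpha>)" using double_m by auto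
  then show ?thesis by (simp add: num_ints_def mult.left_commute)
qed

text \<open>Division with remainder of \<open>t - 1\<close> by \<open>Q\<close>; the shift by one
  reflects that columns and integers are counted from 1.\<close>

lemma symbol_cases:
  assumes "t \<in> {1..num_ints \<alpha> Q}"
  obtains s c where "s \<in> {\<alpha>..<m}" "c \<in> {1..Q}" "t = (s - \<alpha>) * Q + c"
proof -
  have "(t - 1) div Q < m - \<alpha>"
    using assms m_bounds by (auto simp: num_ints_eq less_mult_imp_div_less)
  then show ?thesis
    using assms m_bounds
    by (intro that[of "\<alpha> + (t - 1) div Q" "(t - 1) mod Q + 1"]) (auto simp: Suc_leI)
qed

lemma symbol_mem:
  assumes "s \<in> {\<alpha>..<m}" "c \<in> {1..Q}"
  shows "(s - \<alpha>) * Q + c \<in> {1..num_ints \<alpha> Q}"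
proof -
  have "Suc (s - \<alpha>) * Q \<le> (m - \<alpha>) * Q"
    using assms by (intro mult_right_mono) auto
  then show ?thesis using assms by (auto simp: num_ints_eq)
qed

lemma symbol_eqD:
  assumes "(s - \<alpha>) * Q + c = (s' - \<alpha>) * Q + c'"
    and "s \<in> {\<alpha>..<m}" "c \<in> {1..Q}" "s' \<in> {\<alpha>..<m}" "c' \<in> {1..Q}"
  shows "s = s' \<and> c = c'"
proof -
  have *: "((u - \<alpha>) * Q + w - 1) div Q = u - \<alpha>" "((u - \<alpha>) * Q + w - 1) mod Q = w - 1"
    if "w \<in> {1..Q}" for u w
    using that by (cases w; simp)+
  show ?thesis
    using *[of c s] *[of c' s'] assms by force
qed

lemma arr_P2_mem:
  assumes "f \<in> {1..Q}" "c \<in> {1..Q}" "arr_P2 \<alpha> Q f c = Some t"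
  shows "t \<in> {1..num_ints \<alpha> Q}"
proof -
  obtain s c0 where "s \<in> {\<alpha>..<m}" "c0 \<in> {1..Q}" "t = (s - \<alpha>) * Q + c0"
    using arr_P2_SomeD[OF assms] .
  then show ?thesis using symbol_mem by simp
qed

lemma arr_P2_surj:
  assumes "t \<in> {1..num_ints \<alpha> Q}"
  shows "\<exists>f\<in>{1..Q}. \<exists>c\<in>{1..Q}. arr_P2 \<alpha> Q f c = Some t"
proof -
  obtain s c where sc: "s \<in> {\<alpha>..<m}" "c \<in> {1..Q}" "t = (s - \<alpha>) * Q + c"
    using symbol_cases[OF assms] .
  have "wrap Q (c + s) \<in> {1..Q}" using sc m_bounds by (intro wrap_mem) auto
  with arr_P2_first[OF sc(1,2)] sc show ?thesis by blast
qed

lemma arr_P2_pda: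
  assumes mem: "f1 \<in> {1..Q}" "c1 \<in> {1..Q}" "f2 \<in> {1..Q}" "c2 \<in> {1..Q}"
    and ne: "(f1, c1) \<noteq> (f2, c2)"
    and eq: "arr_P2 \<alpha> Q f1 c1 = Some t" "arr_P2 \<alpha> Q f2 c2 = Some t"
  shows "f1 \<noteq> f2 \<and> c1 \<noteq> c2 \<and> arr_P2 \<alpha> Q f1 c2 = None \<and> arr_P2 \<alpha> Q f2 c1 = None"
proof -
  obtain s c where sc: "s \<in> {\<alpha>..<m}" "c \<in> {1..Q}" "t = (s - \<alpha>) * Q + c"
    and 1: "(f1, c1) = (wrap Q (c + s), c) \<or> (f1, c1) = (wrap Q (c + \<alpha> - 1), wrap Q (c + s))"
    using arr_P2_SomeD[OF mem(1,2) eq(1)] by metis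
  obtain s' c' where sc': "s' \<in> {\<alpha>..<m}" "c' \<in> {1..Q}" "t = (s' - \<alpha>) * Q + c'"
    and 2: "(f2, c2) = (wrap Q (c' + s'), c') \<or> (f2, c2) = (wrap Q (c' + \<alpha> - 1), wrap Q (c' + s'))"
    using arr_P2_SomeD[OF mem(3,4) eq(2)] by metis
  have "s' = s" "c' = c"
    using symbol_eqD[OF _ sc'(1,2) sc(1,2)] sc(3) sc'(3) by simp_all
  note 2 = 2[unfolded this]
  \<comment> \<open>The two occurrences are at (\<open>u\<close>, \<open>c\<close>) and
    (\<open>w\<close>, \<open>u\<close>), so exchanging columns leads to (\<open>u\<close>,
    \<open>u\<close>) and (\<open>w\<close>, \<open>c\<close>).\<close>
  define u where "u = wrap Q (c + s)"
  define w where "w = wrap Q (c + \<alpha> - 1)"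
  have u: "u \<in> {1..Q}" and w: "w \<in> {1..Q}"
    unfolding u_def w_def using sc m_bounds alpha_pos by (intro wrap_mem; auto)+
  have "u = wrap Q (u + 0)" using u by (auto simp: wrap_def)
  then have n1: "arr_P2 \<alpha> Q u u = None"
    using arr_P2_None_iff[OF u u] alpha_pos by blast
  have "w = wrap Q (c + (\<alpha> - 1))" using alpha_pos by (simp add: w_def)
  then have n2: "arr_P2 \<alpha> Q w c = None"
    using arr_P2_None_iff[OF w sc(2)] alpha_pos by (metis diff_less zero_less_one)
  \<comment> \<open>Seen from \<open>c\<close>, the rows \<open>u\<close>, \<open>w\<close>,
    \<open>c\<close> have the offsets \<open>s\<close>, \<open>\<alpha> - 1\<close> and 0, all below
    \<open>Q\<close>, and \<open>s\<close> exceeds the other two.\<close>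
  have n3: "u \<noteq> w" "u \<noteq> c"
    using sc m_bounds alpha_pos unfolding u_def w_def by (auto simp: wrap_def split: if_splits)
  show ?thesis
    using 1[folded u_def w_def] 2[folded u_def w_def] ne n1 n2 n3 by (elim disjE) simp_all
qed

end

section \<open>The block array: index arithmetic, stars and the array property\<close>

lemma block_index:
  fixes Q :: nat
  assumes "j \<in> {1..K}" "f \<in> {1..Q}"
  shows "(j - 1) * Q + f \<in> {1..K * Q}"
    "((j - 1) * Q + f - 1) div Q = j - 1" "((j - 1) * Q + f - 1) mod Q = f - 1"
proof -
  have "Suc (j - 1) * Q \<le> K * Q" using assms by (intro mult_right_mono) auto
  then show "(j - 1) * Q + f \<in> {1..K * Q}" using assms by auto
  show "((j - 1) * Q + f - 1) div Q = j - 1" "((j - 1) * Q + f - 1) mod Q = f - 1"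
    using assms by (cases f; simp)+
qed

lemma bij_betw_block_index:
  fixes Q :: nat
  shows "bij_betw (\<lambda>(j, f). (j - 1) * Q + f) ({1..K} \<times> {1..Q}) {1..K * Q}"
    (is "bij_betw ?h ?A ?B")
proof (rule bij_betwI)
  let ?g = "\<lambda>u. ((u - 1) div Q + 1, (u - 1) mod Q + 1)"
  show "?h \<in> ?A \<rightarrow> ?B" using block_index(1) by fast
  show "?g \<in> ?B \<rightarrow> ?A"
  proof
    fix u assume u: "u \<in> ?B"
    then have "0 < Q" by (auto intro: Nat.gr0I)
    moreover have "(u - 1) div Q < K" using u by (intro less_mult_imp_div_less) auto
    ultimately show "?g u \<in> ?A" by (auto simp: Suc_leI)
  qed
  show "?g (?h x) = x" if mem: "x \<in> ?A" for x
  proof -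
    obtain j f where x: "x = (j, f)" "j \<in> {1..K}" "f \<in> {1..Q}" using mem by blast
    then have "?g (?h x) = (j - 1 + 1, f - 1 + 1)" using block_index(2,3)[OF x(2,3)] by simp
    then show ?thesis using x by simp
  qed
  show "?h (?g u) = u" if "u \<in> ?B" for u
    using that by simp
qed

lemma arr_P_block:
  assumes "j \<in> {1..K}" "f \<in> {1..Q}" "k \<in> {1..K}" "c \<in> {1..Q}"
  shows "arr_P \<alpha> Q ((j - 1) * Q + f) ((k - 1) * Q + c) = (if j = k then arr_P2 \<alpha> Q f c else None)"
  unfolding arr_P_def block_index(2,3)[OF assms(1,2)] block_index(2,3)[OF assms(3,4)]
  using assms by auto

lemma block_index_cases:
  fixes Q :: nat
  assumes "u \<in> {1..K * Q}"
  obtains j f where "j \<in> {1..K}" "f \<in> {1..Q}" "u = (j - 1) * Q + f"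
proof -
  have "u \<in> (\<lambda>(j, f). (j - 1) * Q + f) ` ({1..K} \<times> {1..Q})"
    using assms bij_betw_imp_surj_on[OF bij_betw_block_index[of Q K]] by simp
  then show ?thesis using that by auto
qed

context array_params
begin

lemma arr_P2_None_iff_image:
  assumes "f \<in> {1..Q}" "a \<in> {1..Q}"
  shows "arr_P2 \<alpha> Q f a = None \<longleftrightarrow> f \<in> wrap Q ` {a..<a + \<alpha>}"
  unfolding arr_P2_None_iff[OF assms]
proof
  assume "f \<in> wrap Q ` {a..<a + \<alpha>}"
  then obtain y where "y \<in> {a..<a + \<alpha>}" "f = wrap Q y" by blast
  then show "\<exists>x<\<alpha>. f = wrap Q (a + x)" by (intro exI[of _ "y - a"]) auto
qed auto

text \<open>This serves both the correspondence with the model and the count of the stars in a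
  column.\<close>

lemma stars_arr_P:
  assumes "k \<in> {1..K}" "a \<in> {1..Q}"
  shows "{(j, f) \<in> {1..K} \<times> {1..Q}. arr_P \<alpha> Q ((j - 1) * Q + f) ((k - 1) * Q + a) = None} =
    {(j, f) \<in> {1..K} \<times> {1..Q}. j = k \<longrightarrow> f \<in> wrap Q ` {a..<a + \<alpha>}}"
proof -
  have star: "arr_P \<alpha> Q ((j - 1) * Q + f) ((k - 1) * Q + a) = None \<longleftrightarrow>
      (j = k \<longrightarrow> f \<in> wrap Q ` {a..<a + \<alpha>})" if "j \<in> {1..K}" "f \<in> {1..Q}" for j f
    using arr_P_block[OF that assms] arr_P2_None_iff_image[OF that(2) assms(2)] by simp
  show ?thesis
  proof (rule set_eqI)
    fix p :: "nat \<times> nat"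
    obtain j f where p: "p = (j, f)" by (cases p)
    show "p \<in> {(j, f) \<in> {1..K} \<times> {1..Q}. arr_P \<alpha> Q ((j - 1) * Q + f) ((k - 1) * Q + a) = None} \<longleftrightarrow>
      p \<in> {(j, f) \<in> {1..K} \<times> {1..Q}. j = k \<longrightarrow> f \<in> wrap Q ` {a..<a + \<alpha>}}"
      unfolding p mem_Collect_eq case_prod_conv mem_Sigma_iff using star[of j f] by metis
  qed
qed

lemma card_stars_arr_P:
  assumes "v \<in> {1..K * Q}"
  shows "card {u \<in> {1..K * Q}. arr_P \<alpha> Q u v = None} = (K - 1) * Q + \<alpha>"
proof -
  obtain k a where k: "k \<in> {1..K}" "a \<in> {1..Q}" "v = (k - 1) * Q + a"
    using block_index_cases[OF assms] .
  define A where "A = {(j, f) \<in> {1..K} \<times> {1..Q}. arr_P \<alpha> Q ((j - 1) * Q + f) v = None}"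
  have "bij_betw (\<lambda>(j, f). (j - 1) * Q + f) A {u \<in> {1..K * Q}. arr_P \<alpha> Q u v = None}"
  proof (rule bij_betw_subset[OF bij_betw_block_index[of Q K]])
    show "(\<lambda>(j, f). (j - 1) * Q + f) ` A = {u \<in> {1..K * Q}. arr_P \<alpha> Q u v = None}"
      unfolding A_def bij_betw_imp_surj_on[OF bij_betw_block_index[of Q K], symmetric] by auto
  qed (auto simp: A_def)
  then have "card {u \<in> {1..K * Q}. arr_P \<alpha> Q u v = None} = card A"
    by (rule bij_betw_same_card[symmetric])
  also have "A = ({1..K} - {k}) \<times> {1..Q} \<union> {k} \<times> wrap Q ` {a..<a + \<alpha>}"
  proof -
    have "wrap Q x \<in> {1..Q}" if "x \<in> {a..<a + \<alpha>}" for x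
      using that k alpha_less by (intro wrap_mem) auto
    then show ?thesis unfolding A_def k(3) stars_arr_P[OF k(1,2)] using k(1) by auto
  qed
  also have "card \<dots> = (K - 1) * Q + \<alpha>"
  proof -
    \<comment> \<open>A window of fewer than \<open>Q\<close> consecutive indices does not meet
      itself after wrapping around.\<close>
    have "inj_on (wrap Q) {a..<a + \<alpha>}"
      using k(2) alpha_less by (auto simp: inj_on_def wrap_def split: if_splits)
    then show ?thesis
      using k by (subst card_Un_disjoint) (auto simp: card_cartesian_product card_image)
  qed
  finally show ?thesis .
qed

text \<open>Integers occur only in diagonal blocks. Equal integers in different blocks have their
  exchanged positions in off-diagonal blocks, which are all stars; within one block the claim is
  \<open>arr_P2_pda\<close>.\<close>

lemma is_pda_arr_P:
  "is_pda (K * Q) (K * Q) ((K - 1) * Q + \<alpha>) (num_ints \<alpha> Q) (arr_P \<alpha> Q)" if "0 < K"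
  unfolding is_pda_def
proof (intro conjI ballI impI)
  fix u v assume mem: "u \<in> {1..K * Q}" "v \<in> {1..K * Q}"
  obtain j f where u: "j \<in> {1..K}" "f \<in> {1..Q}" "u = (j - 1) * Q + f"
    using block_index_cases[OF mem(1)] .
  obtain k c where v: "k \<in> {1..K}" "c \<in> {1..Q}" "v = (k - 1) * Q + c"
    using block_index_cases[OF mem(2)] .
  show "arr_P \<alpha> Q u v \<in> insert None (Some ` {1..num_ints \<alpha> Q})"
    unfolding u(3) v(3) arr_P_block[OF u(1,2) v(1,2)]
    using arr_P2_mem[OF u(2) v(2)] by (cases "arr_P2 \<alpha> Q f c") auto
next
  fix v assume "v \<in> {1..K * Q}"
  then show "card {u \<in> {1..K * Q}. arr_P \<alpha> Q u v = None} = (K - 1) * Q + \<alpha>"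
    by (rule card_stars_arr_P)
next
  fix t assume "t \<in> {1..num_ints \<alpha> Q}"
  from arr_P2_surj[OF this] obtain f c
    where fc: "f \<in> {1..Q}" "c \<in> {1..Q}" "arr_P2 \<alpha> Q f c = Some t" by blast
  \<comment> \<open>Each integer is exhibited in the first diagonal block.\<close>
  have "1 \<in> {1..K}" using that by simp
  then show "\<exists>u\<in>{1..K * Q}. \<exists>v\<in>{1..K * Q}. arr_P \<alpha> Q u v = Some t"
    using block_index(1)[of 1 K f Q] block_index(1)[of 1 K c Q] arr_P_block[of 1 K f Q 1 c \<alpha>] fc
    by (intro bexI[of _ "(1 - 1) * Q + f"] bexI[of _ "(1 - 1) * Q + c"]) auto
next
  fix t u1 v1 u2 v2
  assume mem: "u1 \<in> {1..K * Q}" "v1 \<in> {1..K * Q}" "u2 \<in> {1..K * Q}" "v2 \<in> {1..K * Q}"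
    and eq: "(u1, v1) \<noteq> (u2, v2) \<and> arr_P \<alpha> Q u1 v1 = Some t \<and> arr_P \<alpha> Q u2 v2 = Some t"
  obtain j1 f1 where 1: "j1 \<in> {1..K}" "f1 \<in> {1..Q}" "u1 = (j1 - 1) * Q + f1"
    using block_index_cases[OF mem(1)] .
  obtain k1 c1 where 2: "k1 \<in> {1..K}" "c1 \<in> {1..Q}" "v1 = (k1 - 1) * Q + c1"
    using block_index_cases[OF mem(2)] .
  obtain j2 f2 where 3: "j2 \<in> {1..K}" "f2 \<in> {1..Q}" "u2 = (j2 - 1) * Q + f2"
    using block_index_cases[OF mem(3)] .
  obtain k2 c2 where 4: "k2 \<in> {1..K}" "c2 \<in> {1..Q}" "v2 = (k2 - 1) * Q + c2"
    using block_index_cases[OF mem(4)] .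
  have e1: "k1 = j1 \<and> arr_P2 \<alpha> Q f1 c1 = Some t"
    using eq 1 2 arr_P_block[OF 1(1,2) 2(1,2), of \<alpha>] by (auto split: if_splits)
  have e2: "k2 = j2 \<and> arr_P2 \<alpha> Q f2 c2 = Some t"
    using eq 3 4 arr_P_block[OF 3(1,2) 4(1,2), of \<alpha>] by (auto split: if_splits)
  have star: "arr_P \<alpha> Q u1 v2 = (if j1 = j2 then arr_P2 \<alpha> Q f1 c2 else None)"
    "arr_P \<alpha> Q u2 v1 = (if j1 = j2 then arr_P2 \<alpha> Q f2 c1 else None)"
    unfolding 1(3) 2(3) 3(3) 4(3) using arr_P_block[OF 1(1,2) 4(1,2)] arr_P_block[OF 3(1,2) 2(1,2)]
      e1 e2 by auto
  have inj: "(x - 1) * Q + g = (x' - 1) * Q + g' \<longleftrightarrow> x = x' \<and> g = g'"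
    if "x \<in> {1..K}" "g \<in> {1..Q}" "x' \<in> {1..K}" "g' \<in> {1..Q}" for x g x' g'
    using inj_onD[OF bij_betw_imp_inj_on[OF bij_betw_block_index[of Q K]], of "(x, g)" "(x', g')"] that
    by auto
  have "(f1, c1) \<noteq> (f2, c2)" if "j1 = j2"
    using eq e1 e2 1(3) 2(3) 3(3) 4(3) that by auto
  then have "f1 \<noteq> f2 \<and> c1 \<noteq> c2 \<and> arr_P2 \<alpha> Q f1 c2 = None \<and> arr_P2 \<alpha> Q f2 c1 = None" if "j1 = j2"
    using arr_P2_pda[OF 1(2) 2(2) 3(2) 4(2)] e1 e2 that by blast
  then show "u1 \<noteq> u2" "v1 \<noteq> v2" "arr_P \<alpha> Q u1 v2 = None" "arr_P \<alpha> Q u2 v1 = None"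
    unfolding star unfolding 1(3) 2(3) 3(3) 4(3)
      inj[OF 1(1,2) 3(1,2)] inj[OF 2(1,2) 4(1,2)] using e1 e2 by auto
qed

end

section \<open>The coding scheme\<close>

lemma finite_bit_strings: "finite {w :: bits. length w = n}"
proof -
  have "UNIV \<subseteq> {0, 1 :: bit}" using bit.exhaust by blast
  then have "finite (UNIV :: bit set)" by (rule finite_subset) simp
  from finite_lists_length_eq[OF this, of n] show ?thesis by simp
qed

lemma concat_eqD:
  assumes "concat (map g xs) = concat (map h xs)"
    and "\<And>x. x \<in> set xs \<Longrightarrow> length (g x) = length (h x)" and "x \<in> set xs"
  shows "g x = h x"
  using assms by (induction xs) auto

text \<open>Batches carry the labels of their mappers: the labels give the connected mappers, and
  each label occurs with a single content.\<close>

lemma accessible_eqD: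
  assumes "accessible M W k a = accessible M W' k a'"
  shows "connected_mappers M k a = connected_mappers M k a'"
    and "(j, f) \<in> connected_mappers M k a \<Longrightarrow> n \<in> batch M j f \<Longrightarrow> W n = W' n"
proof -
  have fst: "fst ` accessible M V k b = connected_mappers M k b" for V b
    by (simp add: accessible_def image_image case_prod_beta)
  then show "connected_mappers M k a = connected_mappers M k a'"
    using assms by metis
  assume c: "(j, f) \<in> connected_mappers M k a" and n: "n \<in> batch M j f"
  from c have "((j, f), restrict W (batch M j f)) \<in> accessible M W' k a'"
    unfolding assms[symmetric] by (auto simp: accessible_def)
  then have "restrict W (batch M j f) = restrict W' (batch M j f)"
    by (auto simp: accessible_def)
  then show "W n = W' n" using n by (metis restrict_apply')
qed

text \<open>Skipping \<open>k\<close>, an index \<open>l\<close> below \<open>k\<close> has rank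
  \<open>l - 1\<close> and one above \<open>k\<close> has rank \<open>l - 2\<close>; hence the
  witnesses \<open>c + 1\<close> and \<open>c + 2\<close>.\<close>

lemma ex_packet_position:
  assumes "c < K - 1" "k \<in> {1..K}"
  shows "\<exists>l\<in>{1..K} - {k}. card {i \<in> {1..K} - {k}. i < l} = c"
proof (cases "c + 1 < k")
  case True
  then have "{i \<in> {1..K} - {k}. i < c + 1} = {1..c}" using assms by auto
  then show ?thesis using True assms by (intro bexI[of _ "c + 1"]) auto
next
  case False
  then have "{i \<in> {1..K} - {k}. i < c + 2} = {1..c + 1} - {k}" using assms by auto
  then show ?thesis using False assms by (intro bexI[of _ "c + 2"]) auto
qed

text \<open>The packets cover the string: bit \<open>p\<close> is bit \<open>p mod L\<close> of the
  packet of rank \<open>p div L\<close>, where \<open>L\<close> is the packet length.\<close>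

lemma packet_eqD:
  assumes k: "k \<in> {1..num_reducers M}"
    and len: "length u = (num_reducers M - 1) * packet_len M" "length u' = length u"
    and eq: "\<And>l. l \<in> {1..num_reducers M} - {k} \<Longrightarrow> packet M k l u = packet M k l u'"
  shows "u = u'"
proof (rule nth_equalityI)
  fix p assume p: "p < length u"
  define L where "L = packet_len M"
  define c where "c = p div L"
  have "0 < L" using p len by (auto simp: L_def intro: Nat.gr0I)
  have "c < num_reducers M - 1"
    using p len by (auto simp: c_def L_def less_mult_imp_div_less)
  then obtain l where l: "l \<in> {1..num_reducers M} - {k}"
    and c: "card {i \<in> {1..num_reducers M} - {k}. i < l} = c"
    using ex_packet_position k by blast
  have nth: "packet M k l v ! (p mod L) = v ! p" if "length v = length u" for v
  proof -
    have p_eq: "c * L + p mod L = p" by (simp add: c_def)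
    then have "c * L \<le> length v" using p that by linarith
    then show ?thesis
      unfolding packet_def c L_def[symmetric] using \<open>0 < L\<close> by (simp add: p_eq)
  qed
  show "u ! p = u' ! p"
    using nth[of u] nth[of u'] eq[OF l] len by simp
qed (use len in simp)

text \<open>The assumption \<open>packet_dvd\<close> is what allows a string of
  \<open>batch_size M * iv_bits M\<close> bits to be cut into \<open>K - 1\<close> packets of equal
  length.\<close>

locale array_model = array_params +
  fixes K :: nat and M :: madc
  assumes double_alpha: "2 * \<alpha> < Q" and K_gt_1: "1 < K" and model: "cyclic_ppma_madc M"
    and params: "num_reducers M = K" "num_functions M = Q" "access_width M = \<alpha>"
    and packet_dvd: "K - 1 dvd batch_size M * iv_bits M"
begin

abbreviation "outcomes \<equiv> outcome_pmf M (array_scheme M)"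

lemma batch_facts:
  assumes "j \<in> {1..K}" "f \<in> {1..Q}"
  shows "batch M j f \<subseteq> {1..num_files M}" "finite (batch M j f)" "card (batch M j f) = batch_size M"
proof -
  have "(j, f) \<in> mappers M" using assms by (simp add: mappers_def params)
  then show "batch M j f \<subseteq> {1..num_files M}" "card (batch M j f) = batch_size M"
    using model unfolding cyclic_ppma_madc_def by blast+
  then show "finite (batch M j f)" using finite_subset by blast
qed

lemma ex_batch:
  assumes "n \<in> {1..num_files M}"
  obtains j f where "j \<in> {1..K}" "f \<in> {1..Q}" "n \<in> batch M j f"
proof -
  have "n \<in> (\<Union>(k, f)\<in>mappers M. batch M k f)"
    using assms model unfolding cyclic_ppma_madc_def by blast
  then show ?thesis using that by (auto simp: mappers_def params)
qed

lemma num_files_eq: "num_files M = K * Q * batch_size M" "0 < batch_size M" "0 < iv_bits M"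
proof -
  have "K * Q dvd num_files M" "0 < num_files M" "0 < iv_bits M"
    using model by (auto simp: cyclic_ppma_madc_def params)
  then show "num_files M = K * Q * batch_size M" "0 < iv_bits M"
    by (simp_all add: batch_size_def params)
  with \<open>0 < num_files M\<close> show "0 < batch_size M" by (intro Nat.gr0I) auto
qed

lemma packet_len_eq: "(K - 1) * packet_len M = batch_size M * iv_bits M"
  using packet_dvd by (simp add: packet_len_def params)

lemma mem_connected_mappers:
  assumes "k \<in> {1..K}" "a \<in> {1..Q}"
  shows "(j, f) \<in> connected_mappers M k a \<longleftrightarrow>
    j \<in> {1..K} \<and> f \<in> {1..Q} \<and> (j = k \<longrightarrow> arr_P2 \<alpha> Q f a = None)"
  using arr_P2_None_iff_image[OF _ assms(2), of f]
  by (auto simp: connected_mappers_def mappers_def params)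

lemma corresponds_arr_P: "corresponds (arr_P \<alpha> Q) M"
  unfolding corresponds_def connected_mappers_def mappers_def params
  by (intro ballI stars_arr_P)

text \<open>Each starting index lies in the window of the other, so two offsets below \<alpha> add
  up to 0 modulo \<open>Q\<close>; as \<open>2 * \<alpha> < Q\<close>, both are 0.\<close>

lemma connected_mappers_inj:
  assumes eq: "connected_mappers M k a = connected_mappers M k b"
    and mem: "k \<in> {1..K}" "a \<in> {1..Q}" "b \<in> {1..Q}"
  shows "a = b"
proof -
  have self: "(k, c) \<in> connected_mappers M k c" if "c \<in> {1..Q}" for c
  proof -
    have "c = wrap Q (c + 0)" using that by (simp add: wrap_def)
    then show ?thesis
      using arr_P2_None_iff[OF that that] alpha_pos mem that
      by (simp only: mem_connected_mappers) blast
  qed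
  obtain x where "x < \<alpha>" "a = wrap Q (b + x)"
    using self[OF mem(2)] arr_P2_None_iff[OF mem(2,3)] unfolding eq mem_connected_mappers[OF mem(1,3)]
    by blast
  moreover obtain y where "y < \<alpha>" "b = wrap Q (a + y)"
    using self[OF mem(3)] arr_P2_None_iff[OF mem(3,2)]
    unfolding eq[symmetric] mem_connected_mappers[OF mem(1,2)] by blast
  ultimately show ?thesis
    using double_alpha mem by (auto simp: wrap_def split: if_splits)
qed

lemma array_query_eq: "array_query M k a R d = pmf_of_set (pinned_perms {1..Q} a d)"
  by (simp add: array_query_def pinned_perms_def params)

lemma file_law_mem:
  "W \<in> set_pmf (file_law M) \<Longrightarrow> n \<in> {1..num_files M} \<Longrightarrow> length (W n) = file_bits M"
  using model unfolding cyclic_ppma_madc_def by (blast dest: PiE_mem)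

lemma demand_law_mem: "d \<in> set_pmf (demand_law M) \<Longrightarrow> k \<in> {1..K} \<Longrightarrow> d k \<in> {1..Q}"
  using model unfolding cyclic_ppma_madc_def params by (blast dest: PiE_mem)

lemma set_pmf_starts:
  "set_pmf (Pi_pmf {1..K} undefined (\<lambda>_. pmf_of_set {1..Q})) = PiE_dflt {1..K} undefined (\<lambda>_. {1..Q})"
  using m_bounds by (simp add: set_Pi_pmf comp_def)

lemma set_pmf_array_queries:
  assumes "d \<in> set_pmf (demand_law M)" "a \<in> PiE_dflt {1..K} undefined (\<lambda>_. {1..Q})"
  shows "set_pmf (Pi_pmf {1..K} undefined (\<lambda>k. array_query M k (a k) (R k) (d k))) =
    PiE_dflt {1..K} undefined (\<lambda>k. pinned_perms {1..Q} (a k) (d k))"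
proof -
  have "set_pmf (array_query M k (a k) (R k) (d k)) = pinned_perms {1..Q} (a k) (d k)" if "k \<in> {1..K}" for k
  proof -
    have "a k \<in> {1..Q}" using assms(2) that by (simp add: PiE_dflt_def)
    then show ?thesis
      using demand_law_mem[OF assms(1) that]
      by (simp add: array_query_eq pinned_perms_ne finite_pinned_perms)
  qed
  then show ?thesis by (simp add: set_Pi_pmf PiE_dflt_def)
qed

lemma outcomesE:
  assumes "\<omega> \<in> set_pmf outcomes"
  obtains "files \<omega> \<in> set_pmf (file_law M)" "demand \<omega> \<in> set_pmf (demand_law M)"
    "\<And>k. k \<in> {1..K} \<Longrightarrow> start \<omega> k \<in> {1..Q}"
    "\<And>k. k \<in> {1..K} \<Longrightarrow> queries \<omega> k \<in> pinned_perms {1..Q} (start \<omega> k) (demand \<omega> k)"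
proof -
  from assms obtain W d a y where \<omega>: "\<omega> = \<lparr>files = W, demand = d, start = a, queries = y\<rparr>"
    and W: "W \<in> set_pmf (file_law M)" and d: "d \<in> set_pmf (demand_law M)"
    and a: "a \<in> set_pmf (Pi_pmf {1..K} undefined (\<lambda>_. pmf_of_set {1..Q}))"
    and y: "y \<in> set_pmf (Pi_pmf {1..K} undefined (\<lambda>k. array_query M k (a k) (accessible M W k (a k)) (d k)))"
    by (auto simp: outcome_pmf_def params array_scheme_def)
  note a = a[unfolded set_pmf_starts]
  show ?thesis
    using W d a y[unfolded set_pmf_array_queries[OF d a]]
    by (intro that) (simp_all add: \<omega> PiE_dflt_def)
qed

lemma finite_outcomes: "finite (set_pmf outcomes)"
proof -
  have "finite (set_pmf (file_law M))" "finite (set_pmf (demand_law M))"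
    using model unfolding cyclic_ppma_madc_def
    by (auto elim!: finite_subset intro!: finite_PiE finite_bit_strings)
  moreover have "finite (set_pmf (Pi_pmf {1..K} undefined (\<lambda>_. pmf_of_set {1..Q})))"
    unfolding set_pmf_starts by auto
  moreover have "finite (set_pmf (Pi_pmf {1..K} undefined
      (\<lambda>k. array_query M k (a k) (accessible M W k (a k)) (d k))))"
    if "d \<in> set_pmf (demand_law M)"
      "a \<in> set_pmf (Pi_pmf {1..K} undefined (\<lambda>_. pmf_of_set {1..Q}))" for W d a
    using that unfolding set_pmf_starts
    by (subst set_pmf_array_queries) (auto intro: finite_pinned_perms)
  ultimately show ?thesis
    unfolding outcome_pmf_def by (auto simp: params array_scheme_def)
qed

lemma length_map_fun_of:
  assumes "W \<in> set_pmf (file_law M)" "q \<in> {1..Q}" "n \<in> {1..num_files M}"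
  shows "length (map_fun_of M q n (W n)) = iv_bits M"
  using model file_law_mem[OF assms(1,3)] assms(2,3) unfolding cyclic_ppma_madc_def params by blast

lemma length_iv_string:
  assumes "W \<in> set_pmf (file_law M)" "q \<in> {1..Q}" "j \<in> {1..K}" "f \<in> {1..Q}"
  shows "length (iv_string M W q (batch M j f)) = (K - 1) * packet_len M"
proof -
  note B = batch_facts[OF assms(3,4)]
  have "map (\<lambda>n. length (map_fun_of M q n (W n))) (sorted_list_of_set (batch M j f)) =
      map (\<lambda>n. iv_bits M) (sorted_list_of_set (batch M j f))"
    using B length_map_fun_of[OF assms(1,2)] by (intro map_cong) auto
  from arg_cong[OF this, of sum_list] show ?thesis
    using B by (simp only: iv_string_def length_concat map_map comp_def packet_len_eq sum_list_triv) simp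
qed

lemma iv_string_cong:
  assumes "\<And>n. n \<in> batch M j f \<Longrightarrow> W n = W' n" "j \<in> {1..K}" "f \<in> {1..Q}"
  shows "iv_string M W q (batch M j f) = iv_string M W' q (batch M j f)"
  using assms(1) batch_facts(2)[OF assms(2,3)] by (auto simp: iv_string_def intro!: arg_cong[of _ _ concat])

text \<open>All IVs have the same length, so equal concatenations are cut at the same
  places.\<close>

lemma iv_string_eqD:
  assumes "iv_string M W q (batch M j f) = iv_string M W' q (batch M j f)"
    and "W \<in> set_pmf (file_law M)" "W' \<in> set_pmf (file_law M)" "q \<in> {1..Q}"
    and "j \<in> {1..K}" "f \<in> {1..Q}" "n \<in> batch M j f"
  shows "map_fun_of M q n (W n) = map_fun_of M q n (W' n)"
proof (rule concat_eqD[OF assms(1)[unfolded iv_string_def]])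
  note B = batch_facts[OF assms(5,6)]
  show "n \<in> set (sorted_list_of_set (batch M j f))" using B assms(7) by simp
  fix n' assume "n' \<in> set (sorted_list_of_set (batch M j f))"
  then have "n' \<in> {1..num_files M}" using B by auto
  then show "length (map_fun_of M q n' (W n')) = length (map_fun_of M q n' (W' n'))"
    using length_map_fun_of assms by simp
qed

text \<open>The sums sent by \<open>k\<close> range over blocks \<open>j\<close> other than
  \<open>k\<close>, and every batch of those is accessible to \<open>k\<close>.\<close>

lemma encoding: "encoding_req M (array_scheme M)"
  unfolding encoding_req_def
proof
  fix k assume k: "k \<in> {1..num_reducers M}"
  show "cond_ent outcomes (message (array_scheme M) k) (\<lambda>\<omega>. (reach M k \<omega>, queries \<omega>)) = 0"
  proof (rule cond_ent_eq_0[OF finite_outcomes])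
    fix \<omega> \<omega>'
    assume supp: "\<omega> \<in> set_pmf outcomes"
      and eq: "(reach M k \<omega>, queries \<omega>) = (reach M k \<omega>', queries \<omega>')"
    have "packet M j k (iv_string M (files \<omega>) (queries \<omega> j i) (batch M j f)) =
        packet M j k (iv_string M (files \<omega>') (queries \<omega>' j i) (batch M j f))"
      if "j \<in> {1..K} - {k}" "f \<in> {1..Q}" for j f i
    proof -
      have "start \<omega> k \<in> {1..Q}" using outcomesE[OF supp] k params by metis
      then have "(j, f) \<in> connected_mappers M k (start \<omega> k)"
        using mem_connected_mappers k that params by auto
      then have "files \<omega> n = files \<omega>' n" if "n \<in> batch M j f" for n
        using accessible_eqD(2) eq that unfolding reach_def by blast
      then have "iv_string M (files \<omega>) q (batch M j f) = iv_string M (files \<omega>') q (batch M j f)" for q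
        using that by (intro iv_string_cong) auto
      then show ?thesis using eq by simp
    qed
    then show "message (array_scheme M) k \<omega> = message (array_scheme M) k \<omega>'"
      unfolding array_scheme_def scheme.simps array_message_def array_symbol_def xor_strings_def params
      by (intro map_cong refl sum.cong) auto
  qed
qed

text \<open>
  In the symbol \<open>t\<close> sent by \<open>l\<close>, every packet other than the one at \<open>(f, a)\<close> of the block \<open>k\<close>
  belongs to a batch accessible to \<open>k\<close>: by the defining property of the array, the other position
  of \<open>t\<close> in the block \<open>k\<close> lies in a row starred in the column \<open>a\<close>.
\<close>
lemma missing_packet_eq:
  assumes supp: "\<omega> \<in> set_pmf outcomes"
    and reach: "reach M k \<omega> = reach M k \<omega>'" and start: "start \<omega> k = a"
    and queries: "queries \<omega> = queries \<omega>'"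
    and messages: "all_messages M (array_scheme M) \<omega> = all_messages M (array_scheme M) \<omega>'"
    and mem: "k \<in> {1..K}" "l \<in> {1..K} - {k}" "f \<in> {1..Q}"
    and lens: "length (iv_string M (files \<omega>) (queries \<omega> k a) (batch M k f)) =
      length (iv_string M (files \<omega>') (queries \<omega> k a) (batch M k f))"
    and t: "arr_P2 \<alpha> Q f a = Some t"
  shows "packet M k l (iv_string M (files \<omega>) (queries \<omega> k a) (batch M k f)) =
    packet M k l (iv_string M (files \<omega>') (queries \<omega> k a) (batch M k f))"
proof -
  define L where "L = packet_len M"
  \<comment> \<open>The queries of \<omega> are used for both outcomes, so only the files
    vary.\<close>
  define u where "u W = (\<lambda>(j, f, i). packet M j l (iv_string M W (queries \<omega> j i) (batch M j f)))" for W
  define I where "I = {(j, f, i). j \<in> {1..K} - {l} \<and> f \<in> {1..Q} \<and> i \<in> {1..Q} \<and> arr_P2 \<alpha> Q f i = Some t}"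
  have a: "a \<in> {1..Q}" using outcomesE[OF supp] mem(1) start by metis
  have I: "finite I" "(k, f, a) \<in> I"
  proof -
    have "I \<subseteq> {1..K} \<times> {1..Q} \<times> {1..Q}" by (auto simp: I_def)
    then show "finite I" by (rule finite_subset) simp
    show "(k, f, a) \<in> I" using mem a t by (auto simp: I_def)
  qed
  have "t \<in> {1..num_ints \<alpha> Q}" using arr_P2_mem[OF mem(3) a t] .
  have "array_message M l \<omega> = array_message M l \<omega>'"
    using fun_cong[OF messages, of l] mem by (simp add: all_messages_def array_scheme_def params)
  then have "\<forall>s\<in>set [1..<num_ints \<alpha> Q + 1]. array_symbol M l \<omega> s = array_symbol M l \<omega>' s"
    unfolding array_message_def params map_eq_conv .
  then have "array_symbol M l \<omega> t = array_symbol M l \<omega>' t"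
    by (rule bspec) (use \<open>t \<in> {1..num_ints \<alpha> Q}\<close> in auto)
  then have "xor_strings L (u (files \<omega>)) I = xor_strings L (u (files \<omega>')) I"
    unfolding array_symbol_def params u_def I_def L_def queries .
  then have sums: "(\<Sum>i\<in>I. u (files \<omega>) i ! p) = (\<Sum>i\<in>I. u (files \<omega>') i ! p)" if "p < L" for p
    using that by (auto simp: xor_strings_def)
  have others: "u (files \<omega>) x = u (files \<omega>') x" if "x \<in> I - {(k, f, a)}" for x
  proof -
    obtain j g i where x: "x = (j, g, i)" by (cases x)
    have mem': "j \<in> {1..K}" "g \<in> {1..Q}" "i \<in> {1..Q}" "arr_P2 \<alpha> Q g i = Some t" "(j, g, i) \<noteq> (k, f, a)"
      using that x by (auto simp: I_def)
    have "arr_P2 \<alpha> Q g a = None" if "j = k"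
      using arr_P2_pda[OF mem(3) a mem'(2,3) _ t mem'(4)] mem'(5) that by auto
    then have "(j, g) \<in> connected_mappers M k (start \<omega> k)"
      using mem_connected_mappers[OF mem(1) a] mem' start by simp
    then have "files \<omega> n = files \<omega>' n" if "n \<in> batch M j g" for n
      using accessible_eqD(2) reach that unfolding reach_def by blast
    then have "iv_string M (files \<omega>) q (batch M j g) = iv_string M (files \<omega>') q (batch M j g)" for q
      using mem' by (intro iv_string_cong) auto
    then show ?thesis by (simp add: u_def x)
  qed
  \<comment> \<open>The known summands cancel on both sides, bit by bit.\<close>
  have "u (files \<omega>) (k, f, a) ! p = u (files \<omega>') (k, f, a) ! p" if "p < L" for p
  proof -
    have "(\<Sum>x\<in>I - {(k, f, a)}. u (files \<omega>) x ! p) = (\<Sum>x\<in>I - {(k, f, a)}. u (files \<omega>') x ! p)"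
      using others by (intro sum.cong) auto
    with sums[OF that] show ?thesis
      unfolding sum.remove[OF I] by (metis add_right_cancel)
  qed
  \<comment> \<open>Strings of equal length have packets of equal length, at most \<open>L\<close>,
    so the bits \<open>p < L\<close> suffice.\<close>
  then show ?thesis
    using lens by (intro nth_equalityI) (auto simp: packet_def u_def L_def)
qed

text \<open>An IV of an accessible file is known at once. Otherwise its batch is in the own block at
  a position holding an integer \<open>t\<close>, and the symbol \<open>t\<close> of each other
  reducer \<open>l\<close> supplies the packet \<open>l\<close> of the missing string; together
  these packets give the whole string.\<close>

lemma decoding: "decoding_req M (array_scheme M)"
  unfolding decoding_req_def
proof
  fix k assume "k \<in> {1..num_reducers M}"
  then have k: "k \<in> {1..K}" by (simp add: params)
  show "cond_ent outcomes (\<lambda>\<omega>. output_fun M (demand \<omega> k) (files \<omega>))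
    (\<lambda>\<omega>. (reach M k \<omega>, demand \<omega> k, queries \<omega>, all_messages M (array_scheme M) \<omega>)) = 0"
  proof (rule cond_ent_eq_0[OF finite_outcomes])
    fix \<omega> \<omega>'
    assume supp: "\<omega> \<in> set_pmf outcomes" "\<omega>' \<in> set_pmf outcomes"
      and "(reach M k \<omega>, demand \<omega> k, queries \<omega>, all_messages M (array_scheme M) \<omega>) =
        (reach M k \<omega>', demand \<omega>' k, queries \<omega>', all_messages M (array_scheme M) \<omega>')"
    then have eq: "reach M k \<omega> = reach M k \<omega>'" "demand \<omega> k = demand \<omega>' k" "queries \<omega> = queries \<omega>'"
      "all_messages M (array_scheme M) \<omega> = all_messages M (array_scheme M) \<omega>'" by auto
    define a where "a = start \<omega> k"
    define d where "d = demand \<omega> k"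
    have files: "files \<omega> \<in> set_pmf (file_law M)" "files \<omega>' \<in> set_pmf (file_law M)"
      using outcomesE[OF supp(1)] outcomesE[OF supp(2)] by metis+
    \<comment> \<open>The query is pinned at the starting index, so the column \<open>a\<close> of
      the own block stands for the demanded function.\<close>
    have a: "a \<in> {1..Q}" and ya: "queries \<omega> k a = d"
      using outcomesE[OF supp(1)] k unfolding a_def d_def pinned_perms_def by blast+
    have d: "d \<in> {1..Q}"
      unfolding d_def using outcomesE[OF supp(1)] demand_law_mem k by metis
    have "map_fun_of M d n (files \<omega> n) = map_fun_of M d n (files \<omega>' n)" if n: "n \<in> {1..num_files M}" for n
    proof -
      obtain j f where jf: "j \<in> {1..K}" "f \<in> {1..Q}" "n \<in> batch M j f" using ex_batch[OF n] .
      show ?thesis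
      proof (cases "(j, f) \<in> connected_mappers M k a")
        case True
        then have "files \<omega> n = files \<omega>' n"
          using accessible_eqD(2)[OF eq(1)[unfolded reach_def]] jf(3) unfolding a_def by blast
        then show ?thesis by simp
      next
        case False
        then have "j = k" and "arr_P2 \<alpha> Q f a \<noteq> None"
          using mem_connected_mappers[OF k a] jf by auto
        then obtain t where t: "arr_P2 \<alpha> Q f a = Some t" by blast
        have len: "length (iv_string M W d (batch M k f)) = (K - 1) * packet_len M"
          if "W \<in> set_pmf (file_law M)" for W
          using length_iv_string[OF that d k jf(2)] .
        have "iv_string M (files \<omega>) d (batch M k f) = iv_string M (files \<omega>') d (batch M k f)"
        proof (rule packet_eqD)
          fix l assume "l \<in> {1..num_reducers M} - {k}"
          then show "packet M k l (iv_string M (files \<omega>) d (batch M k f)) =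
              packet M k l (iv_string M (files \<omega>') d (batch M k f))"
            using missing_packet_eq[OF supp(1) eq(1) a_def[symmetric] eq(3,4) k _ jf(2) _ t, of l]
            by (simp add: ya params len files)
        qed (use k in \<open>simp_all add: len files params\<close>)
        then show ?thesis
          using iv_string_eqD[OF _ files d k jf(2)] jf(3) \<open>j = k\<close> by blast
      qed
    qed
    then have "output_fun M d (files \<omega>) = output_fun M d (files \<omega>')"
      unfolding output_fun_def by (intro arg_cong[of _ _ "reduce_fun_of M d"] map_cong) auto
    then show "output_fun M (demand \<omega> k) (files \<omega>) = output_fun M (demand \<omega>' k) (files \<omega>')"
      by (simp add: d_def eq(2)[symmetric])
  qed
qed

text \<open>
  The starting index can be read off the labels of the accessible batches. Given it and the own
  demand, the query vector is independent of the other demands.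
\<close>
lemma privacy: "privacy_req M (array_scheme M)"
  unfolding privacy_req_def
proof
  fix k assume "k \<in> {1..num_reducers M}"
  then have k: "k \<in> {1..K}" by (simp add: params)
  define U where "U = pmf_of_set {1..Q}"
  define V where "V = pmf_of_set {y. y permutes {1..Q}}"
  \<comment> \<open>The law of all queries given the own starting index and demand: the own query is
    pinned, the others are uniform permutations.\<close>
  define G where "G a d = do {x \<leftarrow> pmf_of_set (pinned_perms {1..Q} a d);
      f \<leftarrow> Pi_pmf ({1..K} - {k}) undefined (\<lambda>_. V); return_pmf (f(k := x))}" for a d
  \<comment> \<open>The same law as a function of what the reducer knows; the starting index is
    recovered by inverting \<open>connected_mappers M k\<close> on the labels.\<close>
  define H where "H = (\<lambda>(d, R :: batches). G (inv_into {1..Q} (connected_mappers M k) (fst ` R)) d)"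
  define R where "R = do {W \<leftarrow> file_law M; d \<leftarrow> demand_law M; a \<leftarrow> U;
      return_pmf (d, (d k, accessible M W k a))}"
  have H: "H (d, accessible M W k a) = G a d" if "a \<in> {1..Q}" for W a d
  proof -
    have "inj_on (connected_mappers M k) {1..Q}"
      using connected_mappers_inj k by (intro inj_onI) blast
    moreover have "fst ` accessible M W k a = connected_mappers M k a"
      by (simp add: accessible_def image_image case_prod_beta)
    ultimately show ?thesis using that by (simp add: H_def)
  qed
  have inner: "do {a \<leftarrow> Pi_pmf {1..K} undefined (\<lambda>_. U);
        y \<leftarrow> Pi_pmf {1..K} undefined (\<lambda>j. array_query M j (a j) (accessible M W j (a j)) (d j));
        return_pmf (y, a k)} =
      do {a \<leftarrow> U; y \<leftarrow> G a (d k); return_pmf (y, a)}"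
    if "d \<in> set_pmf (demand_law M)" for W d
  proof -
    \<comment> \<open>Averaging over the starting index of \<open>j\<close> removes the dependence
      on \<open>d j\<close>.\<close>
    have "bind_pmf U (\<lambda>a. pmf_of_set (pinned_perms {1..Q} a (d j))) = V" if "j \<in> {1..K} - {k}" for j
      unfolding U_def V_def using demand_law_mem[OF \<open>d \<in> _\<close>] that by (intro bind_pinned_perms) auto
    from Pi_pmf_hide_others[of "{1..K}" k U "\<lambda>j a. pmf_of_set (pinned_perms {1..Q} a (d j))", OF _ k this]
    show ?thesis by (simp add: array_query_eq G_def bind_assoc_pmf bind_return_pmf)
  qed
  show "cond_mut_inf outcomes demand queries (\<lambda>\<omega>. (demand \<omega> k, reach M k \<omega>)) = 0"
  proof (rule cond_mut_inf_eq_0[OF finite_outcomes])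
    have "map_pmf (\<lambda>\<omega>. (queries \<omega>, demand \<omega>, (demand \<omega> k, reach M k \<omega>))) outcomes =
      do {W \<leftarrow> file_law M; d \<leftarrow> demand_law M;
          (y, a) \<leftarrow> do {a \<leftarrow> Pi_pmf {1..K} undefined (\<lambda>_. U);
            y \<leftarrow> Pi_pmf {1..K} undefined (\<lambda>j. array_query M j (a j) (accessible M W j (a j)) (d j));
            return_pmf (y, a k)};
          return_pmf (y, d, (d k, accessible M W k a))}"
      by (simp add: outcome_pmf_def map_bind_pmf bind_assoc_pmf bind_return_pmf array_scheme_def
          params reach_def U_def)
    also have "\<dots> = do {W \<leftarrow> file_law M; d \<leftarrow> demand_law M; a \<leftarrow> U; y \<leftarrow> G a (d k);
          return_pmf (y, d, (d k, accessible M W k a))}"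
      by (rule bind_pmf_cong[OF refl], rule bind_pmf_cong[OF refl], simp only: inner)
        (simp add: bind_assoc_pmf bind_return_pmf)
    \<comment> \<open>\<open>G\<close> may be replaced by \<open>H\<close> because only starting
      indices in \<open>{1..Q}\<close> are drawn.\<close>
    also have "\<dots> = do {W \<leftarrow> file_law M; d \<leftarrow> demand_law M; a \<leftarrow> U; y \<leftarrow> H (d k, accessible M W k a);
          return_pmf (y, d, (d k, accessible M W k a))}"
      using m_bounds by (intro bind_pmf_cong refl) (simp add: H U_def)
    also have "\<dots> = do {(x, z) \<leftarrow> R; y \<leftarrow> H z; return_pmf (y, x, z)}"
      by (simp add: R_def bind_assoc_pmf bind_return_pmf)
    finally show "map_pmf (\<lambda>\<omega>. (queries \<omega>, demand \<omega>, (demand \<omega> k, reach M k \<omega>))) outcomes =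
      do {(x, z) \<leftarrow> R; y \<leftarrow> H z; return_pmf (y, x, z)}" .
  qed
qed

section \<open>The two loads\<close>

lemma computation_load_eq_1: "computation_load M = 1"
proof -
  have "(\<Sum>(k, f)\<in>mappers M. real (card (batch M k f))) = (\<Sum>_\<in>mappers M. real (batch_size M))"
    using batch_facts(3) by (intro sum.cong) (auto simp: mappers_def params)
  also have "\<dots> = real (num_files M)"
    by (simp add: mappers_def params num_files_eq(1))
  finally show ?thesis
    using num_files_eq K_gt_1 m_bounds by (simp add: computation_load_def)
qed

text \<open>Each of the \<open>K\<close> reducers sends \<open>num_ints \<alpha> Q\<close> symbols
  of \<open>packet_len M\<close> bits, whatever the outcome; the factor \<open>K\<close> cancels
  against \<open>num_files M = K * Q * batch_size M\<close>.\<close>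

lemma communication_load_eq:
  "communication_load M (array_scheme M) \<omega> = (real Q - real \<alpha>) / (2 * real Q * (real K - 1))"
proof -
  have "sum_list (map length (message (array_scheme M) k \<omega>)) = num_ints \<alpha> Q * packet_len M" for k
    by (simp add: array_scheme_def array_message_def array_symbol_def xor_strings_def comp_def
        sum_list_triv params)
  then have load: "communication_load M (array_scheme M) \<omega> =
      real K * real (num_ints \<alpha> Q) * real (packet_len M) / real (Q * num_files M * iv_bits M)"
    by (simp add: communication_load_def params)
  have "Q - \<alpha> = 2 * (m - \<alpha>)" using double_m by auto
  then have "2 * num_ints \<alpha> Q = Q * (Q - \<alpha>)" by (simp add: num_ints_def)
  then have "real (2 * num_ints \<alpha> Q) = real (Q * (Q - \<alpha>))" by (rule arg_cong)
  then have n: "real (num_ints \<alpha> Q) = real Q * (real Q - real \<alpha>) / 2"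
    using alpha_less by (simp add: of_nat_diff)
  have "real (K - 1) * real (packet_len M) = real (batch_size M * iv_bits M)"
    unfolding packet_len_eq[symmetric] by simp
  then have L: "real (packet_len M) = real (batch_size M) * real (iv_bits M) / (real K - 1)"
    using K_gt_1 by (simp add: of_nat_diff field_simps)
  have "real K - 1 \<noteq> 0" using K_gt_1 by simp
  then show ?thesis
    unfolding load n L num_files_eq(1) using num_files_eq(2,3) K_gt_1 m_bounds
    by (simp add: divide_simps)
qed

end

theorem theorem2:
  fixes \<alpha> K Q :: nat and M :: madc
  assumes "0 < \<alpha>" and "1 < K" and "0 < Q"
    and "2 * \<alpha> < Q" and "even (Q + \<alpha>)"
    and "cyclic_ppma_madc M"
    and "num_reducers M = K" and "num_functions M = Q" and "access_width M = \<alpha>"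
    and "K - 1 dvd batch_size M * iv_bits M"
  shows "is_pda (K * Q) (K * Q) ((K - 1) * Q + \<alpha>) (Q * (Q - \<alpha>) div 2) (arr_P \<alpha> Q) \<and>
    corresponds (arr_P \<alpha> Q) M \<and>
    encoding_req M (array_scheme M) \<and>
    decoding_req M (array_scheme M) \<and>
    privacy_req M (array_scheme M) \<and>
    computation_load M = 1 \<and>
    (\<forall>\<omega>\<in>set_pmf (outcome_pmf M (array_scheme M)).
       communication_load M (array_scheme M) \<omega> =
         (real Q - real \<alpha>) / (2 * real Q * (real K - 1)))"
proof -
  \<comment> \<open>The quotient \<open>(Q + \<alpha>) div 2\<close> is exact since
    \<open>Q + \<alpha>\<close> is even.\<close>
  interpret array_model \<alpha> Q "(Q + \<alpha>) div 2" K M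
    by unfold_locales (use assms in simp_all)
  have "is_pda (K * Q) (K * Q) ((K - 1) * Q + \<alpha>) (Q * (Q - \<alpha>) div 2) (arr_P \<alpha> Q)"
    using is_pda_arr_P[of K] assms(2) by (simp add: num_ints_def)
  then show ?thesis
    by (intro conjI ballI corresponds_arr_P encoding decoding privacy computation_load_eq_1
        communication_load_eq)
qed

end
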